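(* Let $u$ be a generalized solution to the Perona-Malik equation $u_t=(\varphi'(u_x))_x$ with homogeneous Neumann boundary conditions in the interval $(0,1)$, obtained through semi-discrete approximation. Then the following hold. (1) (Maximum principle) For every $t\ge0$, let $M^+(t)$ and $M^-(t)$ denote, respectively, the essential supremum and the essential infimum of the function $x\mapsto u(t,x)$ in $(0,1)$. Then $t\mapsto M^+(t)$ is nonincreasing on $[0,+\infty)$, and $t\mapsto M^-(t)$ is nondecreasing on $[0,+\infty)$. (2) (Monotonicity of the total variation) For every $t\ge0$, let $TV^+(t)$ and $TV^-(t)$ denote the positive and negative total variation of the function $x\mapsto u(t,x)$ in $(0,1)$. Then the functions $t\mapsto TV^+(t)$ and $t\mapsto TV^-(t)$ are nonincreasing on $[0,+\infty)$.
   Context: Standing assumptions on $\varphi$: $\varphi:\mathbb{R}\to\mathbb{R}$ is an even function of class $C^2$ with bounded second derivative, $\varphi(0)=0$, $\varphi''(0)>0$; there exists $\sigma_1>0$ such that $\varphi'$ is nondecreasing in $[0,\sigma_1]$ and nonincreasing in $[\sigma_1,+\infty)$; and $\lim_{\sigma\to+\infty}\varphi'(\sigma)=0$. Discrete notation: for a function $w$ of a discrete index and a positive integer $n$, $[D_n^+w](i):=n(w(i+1)-w(i))$ and $[D_n^-w](i):=n(w(i)-w(i-1))$. For $w:\{1,\dots,n\}\to\mathbb{R}$, $\|w\|_\infty:=\max_{1\le i\le n}|w(i)|$ and $TV(w):=\sum_{i=1}^{n-1}|w(i+1)-w(i)|$. Positive/negative total variation: for $u\in BV((a,b))$, identified with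 its left-continuous representative, $$TV^+(u):=\sup\left\{\sum_{i=1}^{2m}(-1)^iu(x_i):m\ge1,\ a<x_1\le x_2\le\dots\le x_{2m}<b\right\},\qquad TV^-(u):=TV^+(-u).$$ Generalized solution: a generalized solution to $u_t=(\varphi'(u_x))_x$ with homogeneous Neumann boundary conditions in $(0,1)$, obtained through semi-discrete approximation, is any $u\in C^0([0,+\infty);L^2((0,1)))$ for which there exist an increasing sequence $\{n_k\}$ of positive integers and functions $u_k:[0,+\infty)\times\{1,\dots,n_k\}\to\mathbb{R}$ such that: (a) there exists $M\in\mathbb{R}$ with $\|u_k(0,\cdot)\|_\infty+TV(u_k(0,\cdot))\le M$ for every $k\ge1$; (b) for every $k$, $u_k$ is differentiable with respect to the first variable and $$u_k'(t,i)=D_{n_k}^-\left(\varphi'\left(D_{n_k}^+u_k(t,i)\right)\right)=n_k\left\{\varphi'(D^+_{n_k}u_k(t,i))-\varphi'(D^+_{n_k}u_k(t,i-1))\right\}$$ for all $t\ge0$, $i\in\{1,\dots,n_k\}$, where $u_k$ is extended by $u_k(t,0)=u_k(t,1)$ and $u_k(t,n_k+1)=u_k(t,n_k)$ (here $'$ on $u_k$ denotes the time derivative); (c) for every $T>0$, $\lim_{k\to+\infty}\sup_{t\in[0,T]}\|u_k(t,\lceil n_kx\rceil)-u(t,x)\|_{L^2((0,1))}=0$. It is known that for such $u$ one has $u(t,\cdot)\in BV((0,1))$ for every $t\ge0$. *)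

theory Defs
  imports "HOL-Analysis.Analysis" "HOL-Probability.Essential_Supremum"
begin

text \<open>Standing assumptions on the nonlinearity; \<open>deriv \<phi>\<close> and \<open>deriv (deriv \<phi>)\<close> are
  the genuine derivatives because of the differentiability clauses.\<close>

definition perona_malik_nonlinearity :: "(real \<Rightarrow> real) \<Rightarrow> bool" where
  "perona_malik_nonlinearity \<phi> \<longleftrightarrow>
     (\<forall>s. \<phi> (- s) = \<phi> s) \<and>
     (\<forall>s. \<phi> differentiable (at s)) \<and>
     (\<forall>s. deriv \<phi> differentiable (at s)) \<and>
     continuous_on UNIV (deriv (deriv \<phi>)) \<and>
     bounded (range (deriv (deriv \<phi>))) \<and>
     \<phi> 0 = 0 \<and>
     deriv (deriv \<phi>) 0 > 0 \<and>
     (\<exists>\<sigma>\<^sub>1>0. mono_on {0..\<sigma>\<^sub>1} (deriv \<phi>) \<and> antimono_on {\<sigma>\<^sub>1..} (deriv \<phi>)) \<and>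
     (deriv \<phi> \<longlongrightarrow> 0) at_top"

definition D_plus :: "nat \<Rightarrow> (nat \<Rightarrow> real) \<Rightarrow> nat \<Rightarrow> real" where
  "D_plus n w i = real n * (w (i + 1) - w i)"

text \<open>Only meaningful for \<open>i \<ge> 1\<close>, since the subtraction in the index is truncated.\<close>

definition D_minus :: "nat \<Rightarrow> (nat \<Rightarrow> real) \<Rightarrow> nat \<Rightarrow> real" where
  "D_minus n w i = real n * (w i - w (i - 1))"

text \<open>Discrete Neumann boundary condition: a function on \<open>{1..n}\<close> is extended to
  \<open>{0..n+1}\<close> by repeating its first and last value.\<close>

definition neumann_ext :: "nat \<Rightarrow> (nat \<Rightarrow> real) \<Rightarrow> nat \<Rightarrow> real" where
  "neumann_ext n w i = (if i = 0 then w 1 else if i = n + 1 then w n else w i)"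

definition discrete_sup_norm :: "nat \<Rightarrow> (nat \<Rightarrow> real) \<Rightarrow> real" where
  "discrete_sup_norm n w = Max ((\<lambda>i. \<bar>w i\<bar>) ` {1..n})"

definition discrete_TV :: "nat \<Rightarrow> (nat \<Rightarrow> real) \<Rightarrow> real" where
  "discrete_TV n w = (\<Sum>i\<in>{1..<n}. \<bar>w (i + 1) - w i\<bar>)"

text \<open>Elements of \<open>L\<^sup>2((0,1))\<close> are represented by functions on the reals whose values outside
  \<open>(0,1)\<close> are irrelevant; they are only ever compared up to null sets.\<close>

abbreviation unit_interval_measure :: "real measure" where
  "unit_interval_measure \<equiv> lebesgue_on {0<..<1}"

definition in_L2 :: "(real \<Rightarrow> real) \<Rightarrow> bool" where
  "in_L2 f \<longleftrightarrow> f \<in> borel_measurable unit_interval_measure \<and>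
     integrable unit_interval_measure (\<lambda>x. (f x)\<^sup>2)"

definition L2_norm :: "(real \<Rightarrow> real) \<Rightarrow> real" where
  "L2_norm f = sqrt (LINT x|unit_interval_measure. (f x)\<^sup>2)"

definition continuous_into_L2 :: "(real \<Rightarrow> real \<Rightarrow> real) \<Rightarrow> bool" where
  "continuous_into_L2 u \<longleftrightarrow>
     (\<forall>t\<ge>0. in_L2 (u t)) \<and>
     (\<forall>t\<^sub>0\<ge>0. ((\<lambda>t. L2_norm (\<lambda>x. u t x - u t\<^sub>0 x)) \<longlongrightarrow> 0) (at t\<^sub>0 within {0..}))"

definition generalized_solution ::
    "(real \<Rightarrow> real) \<Rightarrow> (real \<Rightarrow> real \<Rightarrow> real) \<Rightarrow> bool" where
  "generalized_solution \<phi> u \<longleftrightarrow> continuous_into_L2 u \<and>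
     (\<exists>(n :: nat \<Rightarrow> nat) (U :: nat \<Rightarrow> real \<Rightarrow> nat \<Rightarrow> real).
        strict_mono n \<and> (\<forall>k. n k > 0) \<and>
        (\<exists>M. \<forall>k. discrete_sup_norm (n k) (U k 0) + discrete_TV (n k) (U k 0) \<le> M) \<and>
        (\<forall>k. \<forall>t\<ge>0. \<forall>i\<in>{1..n k}.
           ((\<lambda>s. U k s i) has_real_derivative
              D_minus (n k) (\<lambda>j. deriv \<phi> (D_plus (n k) (neumann_ext (n k) (U k t)) j)) i)
           (at t within {0..})) \<and>
        (\<forall>T>0. (\<lambda>k. SUP t\<in>{0..T}.
             ereal (L2_norm (\<lambda>x. U k t (nat \<lceil>real (n k) * x\<rceil>) - u t x))) \<longlonglongrightarrow> 0))"

text \<open>Counterpart of \<^const>\<open>esssup\<close>, which is the \<^const>\<open>Limsup\<close> along the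
  almost-everywhere filter.\<close>

definition essinf :: "'a measure \<Rightarrow> ('a \<Rightarrow> ereal) \<Rightarrow> ereal" where
  "essinf M f = (if f \<in> borel_measurable M then Liminf (ae_filter M) f else bot)"

definition is_left_cont_rep ::
    "real \<Rightarrow> real \<Rightarrow> (real \<Rightarrow> real) \<Rightarrow> (real \<Rightarrow> real) \<Rightarrow> bool" where
  "is_left_cont_rep a b f g \<longleftrightarrow>
     (AE x in lebesgue_on {a<..<b}. g x = f x) \<and>
     (\<forall>x\<in>{a<..<b}. continuous (at_left x) g)"

text \<open>Every \<open>f\<close> in \<open>BV((a,b))\<close> has a left-continuous representative, and it is unique
  on \<open>(a,b)\<close>; the choice made by \<open>SOME\<close> therefore only affects values outside \<open>(a,b)\<close>.\<close>

lemma left_cont_rep_unique: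
  assumes g: "is_left_cont_rep a b f g" and h: "is_left_cont_rep a b f h"
    and x: "x \<in> {a<..<b}"
  shows "g x = h x"
proof (rule ccontr)
  assume ne: "g x \<noteq> h x"
  have "((\<lambda>y. g y - h y) \<longlongrightarrow> g x - h x) (at_left x)"
    using g h x unfolding is_left_cont_rep_def continuous_within
    by (auto intro!: tendsto_diff)
  then have "eventually (\<lambda>y. g y - h y \<noteq> 0) (at_left x)"
    using ne by (intro tendsto_imp_eventually_ne) auto
  then obtain c where c: "c < x" "\<And>y. c < y \<Longrightarrow> y < x \<Longrightarrow> g y \<noteq> h y"
    unfolding eventually_at_left_field by auto
  define d where "d = max a c"
  have d: "d < x" using c x by (auto simp: d_def)
  have "AE y in lebesgue_on {a<..<b}. g y = h y"
    using g h unfolding is_left_cont_rep_def by (auto elim: AE_mp)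
  then have "AE y in lebesgue. y \<in> {a<..<b} \<longrightarrow> g y = h y"
    by (subst (asm) AE_restrict_space_iff) auto
  then have "AE y in lebesgue. y \<notin> {d<..<x}"
    by eventually_elim (use c x in \<open>auto simp: d_def\<close>)
  then have "{d<..<x} \<in> null_sets lebesgue"
    by (subst AE_iff_null_sets) auto
  then have "emeasure lebesgue {d<..<x} = 0" by auto
  then show False using d by simp
qed

definition left_cont_rep :: "real \<Rightarrow> real \<Rightarrow> (real \<Rightarrow> real) \<Rightarrow> real \<Rightarrow> real" where
  "left_cont_rep a b f = (SOME g. is_left_cont_rep a b f g)"

definition TV_plus :: "real \<Rightarrow> real \<Rightarrow> (real \<Rightarrow> real) \<Rightarrow> ereal" where
  "TV_plus a b f =
     Sup {ereal (\<Sum>i=1..2*m. (-1) ^ i * left_cont_rep a b f (x i)) | (m :: nat) (x :: nat \<Rightarrow> real).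
            1 \<le> m \<and> a < x 1 \<and> (\<forall>i\<in>{1..<2*m}. x i \<le> x (i + 1)) \<and> x (2*m) < b}"

definition TV_minus :: "real \<Rightarrow> real \<Rightarrow> (real \<Rightarrow> real) \<Rightarrow> ereal" where
  "TV_minus a b f = TV_plus a b (\<lambda>x. - f x)"

end

theory Submission
  imports Defs "HOL-Probability.Helly_Selection"
begin

text \<open>
  For each fixed \<open>k\<close> the discrete maximum, minimum and variations of \<open>U k\<close> are monotone in time,
  but this does not pass to the limit between two times \<open>s \<le> t\<close>: the approximations \<open>U k s\<close> may
  carry thin spikes that disappear in \<open>u s\<close>, so that their variation exceeds that of \<open>u s\<close>.

  The way out is that each solution of the nonlinear system solves a linear one. Since \<open>\<phi>'\<close> is
  odd, Lipschitz and nonnegative on the half line, \<open>\<phi>' \<sigma> = a(\<sigma>) * \<sigma>\<close> with a bounded conductivity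
  \<open>a \<ge> 0\<close>. With the conductivities computed along \<open>U k\<close>, the function \<open>U k\<close> solves a linear
  diffusion equation with time-dependent nonnegative coefficients. This equation can be run
  from any other data \<open>W k\<close> given at time \<open>s\<close>. The resulting companion \<open>V k\<close> inherits from
  \<open>W k\<close> every bound on its values and on its positive and total variation, and its \<open>L1\<close>
  distance to \<open>U k\<close> does not increase. Hence if \<open>W k\<close> tends to \<open>u s\<close> then \<open>V k\<close> tends to \<open>u t\<close>.
  The companion is built from Euler steps, at the price of an arbitrarily small error
  (\<open>companion_evolution\<close>, \<open>companion_limit\<close>).

  Taking for \<open>W k\<close> the values of the left-continuous representative of \<open>u s\<close> at points of a
  grid, neither the supremum nor the positive variation of \<open>W k\<close> exceeds that of \<open>u s\<close>. Both
  bounds hold for \<open>V k\<close> and survive in the limit \<open>u t\<close> by lower semicontinuity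
  (\<open>alternating_sum_lsc\<close>, \<open>grid_l1_limit_AE_le\<close>). That such representatives exist is itself a
  consequence: companions started from \<open>U k 0\<close> have uniformly bounded variation at time \<open>t\<close>,
  and Helly selection applies (\<open>bounded_variation_limit_left_cont_rep\<close>). The statements on the
  infimum and the negative variation follow by the symmetry \<open>u \<mapsto> -u\<close>.
\<close>

section \<open>Linear diffusion steps on a grid\<close>

text \<open>One explicit Euler step of a linear diffusion on the grid \<open>{1..n}\<close>, where \<open>c i\<close> is
  the time step times the conductivity of the edge between \<open>i\<close> and \<open>i + 1\<close>. The Neumann
  condition is the vanishing of \<open>c 0\<close> and \<open>c n\<close>, which also makes the values of the grid
  function outside \<open>{1..n}\<close> irrelevant.\<close>

definition diffusion_step :: "(nat \<Rightarrow> real) \<Rightarrow> (nat \<Rightarrow> real) \<Rightarrow> nat \<Rightarrow> real" where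
  "diffusion_step c v i = v i + (c i * (v (i + 1) - v i) - c (i - 1) * (v i - v (i - 1)))"

text \<open>The bound \<open>1/2\<close> is the stability condition of the explicit scheme: it makes each new value a
  convex combination of the old values, and each new jump a nonnegative combination of the
  old jumps.\<close>

definition step_weights :: "nat \<Rightarrow> (nat \<Rightarrow> real) \<Rightarrow> bool" where
  "step_weights n c \<longleftrightarrow> c 0 = 0 \<and> c n = 0 \<and> (\<forall>i. 0 \<le> c i \<and> c i \<le> 1/2)"

lemma diffusion_step_diff:
  "diffusion_step c v i - diffusion_step c w i = diffusion_step c (\<lambda>j. v j - w j) i"
  by (simp add: diffusion_step_def algebra_simps)

lemma diffusion_step_uminus: "diffusion_step c (\<lambda>j. - v j) i = - diffusion_step c v i"
  by (simp add: diffusion_step_def algebra_simps)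

lemma diffusion_step_const: "diffusion_step c (\<lambda>j. b) i = b"
  by (simp add: diffusion_step_def)

lemma diffusion_step_convex:
  "diffusion_step c v i = c i * v (i + 1) + (1 - c i - c (i - 1)) * v i + c (i - 1) * v (i - 1)"
  by (simp add: diffusion_step_def algebra_simps)

lemma diffusion_step_mono:
  assumes "step_weights n c" "i \<in> {1..n}" "\<And>j. j \<in> {1..n} \<Longrightarrow> v j \<le> w j"
  shows "diffusion_step c v i \<le> diffusion_step c w i"
proof -
  have c: "0 \<le> c j" "c j \<le> 1/2" for j
    using assms(1) by (auto simp: step_weights_def)
  have "c i * v (i + 1) \<le> c i * w (i + 1)"
    using assms c by (cases "i = n") (auto intro!: mult_left_mono simp: step_weights_def)
  moreover have "c (i - 1) * v (i - 1) \<le> c (i - 1) * w (i - 1)"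
  proof (cases "i = 1")
    case False
    then have "i - 1 \<in> {1..n}" using assms(2) by auto
    then show ?thesis using assms(3) c by (intro mult_left_mono) auto
  qed (use assms in \<open>simp add: step_weights_def\<close>)
  moreover have "(1 - c i - c (i - 1)) * v i \<le> (1 - c i - c (i - 1)) * w i"
    using assms c[of i] c[of "i-1"] by (intro mult_left_mono) auto
  ultimately show ?thesis
    unfolding diffusion_step_convex by linarith
qed

lemma diffusion_step_le:
  assumes "step_weights n c" "i \<in> {1..n}" "\<And>j. j \<in> {1..n} \<Longrightarrow> v j \<le> b"
  shows "diffusion_step c v i \<le> b"
  using diffusion_step_mono[of n c i v "\<lambda>_. b"] assms by (simp add: diffusion_step_const)

lemma sum_diffusion_step:
  assumes "c 0 = 0" "c n = 0"
  shows "(\<Sum>i=1..n. diffusion_step c v i) = (\<Sum>i=1..n. v i)"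
proof -
  define b where "b i = c i * (v (i + 1) - v i)" for i
  have "(\<Sum>i=1..n. diffusion_step c v i) = (\<Sum>i=1..n. v i + (b i - b (i - 1)))"
    by (rule sum.cong) (auto simp: diffusion_step_def b_def)
  also have "\<dots> = (\<Sum>i=1..n. v i) + (\<Sum>i=1..n. b i - b (i - 1))"
    by (simp add: sum.distrib)
  also have "(\<Sum>i=1..n. b i - b (i - 1)) = b n - b 0"
    by (induction n) auto
  finally show ?thesis using assms by (simp add: b_def)
qed

text \<open>By monotonicity, \<open>\<bar>diffusion_step c v\<bar>\<close> is dominated by \<open>diffusion_step c \<bar>v\<bar>\<close>,
  and the step conserves the total mass.\<close>

lemma diffusion_step_l1_contraction:
  assumes "step_weights n c"
  shows "(\<Sum>i=1..n. \<bar>diffusion_step c v i\<bar>) \<le> (\<Sum>i=1..n. \<bar>v i\<bar>)"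
proof -
  have "\<bar>diffusion_step c v i\<bar> \<le> diffusion_step c (\<lambda>j. \<bar>v j\<bar>) i" if "i \<in> {1..n}" for i
    using diffusion_step_mono[OF assms that, of v "\<lambda>j. \<bar>v j\<bar>"]
      diffusion_step_mono[OF assms that, of "\<lambda>j. - v j" "\<lambda>j. \<bar>v j\<bar>"]
    by (simp add: diffusion_step_uminus abs_le_iff)
  then have "(\<Sum>i=1..n. \<bar>diffusion_step c v i\<bar>) \<le> (\<Sum>i=1..n. diffusion_step c (\<lambda>j. \<bar>v j\<bar>) i)"
    by (rule sum_mono)
  also have "\<dots> = (\<Sum>i=1..n. \<bar>v i\<bar>)"
    using assms by (intro sum_diffusion_step) (auto simp: step_weights_def)
  finally show ?thesis .
qed

text \<open>The costs that matter are the absolute value and the positive part; they turn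
  \<open>jump_sum\<close> below into the discrete total variation and the discrete positive variation.\<close>

definition sublinear_jump_cost :: "(real \<Rightarrow> real) \<Rightarrow> bool" where
  "sublinear_jump_cost f \<longleftrightarrow> (\<forall>x. 0 \<le> f x) \<and> (\<forall>x y. f (x + y) \<le> f x + f y) \<and>
     (\<forall>r\<ge>0. \<forall>x. f (r * x) = r * f x)"

lemma sublinear_jump_cost_abs: "sublinear_jump_cost abs"
  by (auto simp: sublinear_jump_cost_def abs_mult)

lemma sublinear_jump_cost_pos: "sublinear_jump_cost (max 0)"
  by (auto simp: sublinear_jump_cost_def max_def zero_le_mult_iff mult_le_0_iff not_le)

definition jump_sum :: "(real \<Rightarrow> real) \<Rightarrow> nat \<Rightarrow> (nat \<Rightarrow> real) \<Rightarrow> real" where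
  "jump_sum f n v = (\<Sum>i=1..<n. f (v (i + 1) - v i))"

text \<open>The jumps \<open>d i = v (i + 1) - v i\<close> of a grid function evolve by the diffusion step in
  divergence form, so sublinearity bounds the new cost at \<open>i\<close> by \<open>f (d i)\<close> plus an increment
  \<open>b (i + 1) - b i\<close>. After summation only the boundary terms survive, and they have the
  good sign because \<open>c 0 = c n = 0\<close>.\<close>

lemma diffusion_step_jump_sum:
  assumes "step_weights n c" "sublinear_jump_cost f"
  shows "jump_sum f n (diffusion_step c v) \<le> jump_sum f n v"
proof (cases "n = 0")
  case True then show ?thesis by (simp add: jump_sum_def)
next
  case False
  define d where "d i = v (i + 1) - v i" for i
  have c: "0 \<le> c j" "c j \<le> 1/2" "c 0 = 0" "c n = 0" for j
    using assms(1) by (auto simp: step_weights_def)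
  have f: "0 \<le> f x" "f (x + y) \<le> f x + f y" "r \<ge> 0 \<Longrightarrow> f (r * x) = r * f x" for x y r
    using assms(2) by (auto simp: sublinear_jump_cost_def)
  define b where "b i = c i * f (d i) - c (i - 1) * f (d (i - 1))" for i
  have step: "f (diffusion_step c v (i + 1) - diffusion_step c v i) \<le> f (d i) + (b (i + 1) - b i)"
    if "i \<in> {1..<n}" for i
  proof -
    have "f (c (i + 1) * d (i + 1) + ((1 - 2 * c i) * d i + c (i - 1) * d (i - 1)))
        \<le> f (c (i + 1) * d (i + 1)) + (f ((1 - 2 * c i) * d i) + f (c (i - 1) * d (i - 1)))"
      using f(2)[of "c (i + 1) * d (i + 1)" "(1 - 2 * c i) * d i + c (i - 1) * d (i - 1)"]
        f(2)[of "(1 - 2 * c i) * d i" "c (i - 1) * d (i - 1)"] by linarith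
    also have "\<dots> = c (i + 1) * f (d (i + 1)) + ((1 - 2 * c i) * f (d i) + c (i - 1) * f (d (i - 1)))"
      using c(2)[of i] by (simp add: f(3) c(1))
    finally show ?thesis
      using that by (simp add: diffusion_step_def d_def b_def algebra_simps)
  qed
  have "jump_sum f n (diffusion_step c v) \<le> (\<Sum>i=1..<n. f (d i) + (b (i + 1) - b i))"
    unfolding jump_sum_def by (rule sum_mono) (use step in auto)
  also have "\<dots> = jump_sum f n v + (\<Sum>i=1..<n. b (Suc i) - b i)"
    by (simp add: sum.distrib jump_sum_def d_def)
  also have "(\<Sum>i=1..<n. b (Suc i) - b i) = b n - b 1"
    using False by (intro sum_Suc_diff') auto
  also have "b n - b 1 \<le> 0"
  proof -
    have "0 \<le> c (n - 1) * f (d (n - 1))" "0 \<le> c 1 * f (d 1)" using c(1) f(1) by auto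
    then show ?thesis using c(3,4) by (simp add: b_def)
  qed
  finally show ?thesis by simp
qed

text \<open>The properties that every composition of diffusion steps has with respect to its
  starting point.\<close>

definition less_oscillating :: "nat \<Rightarrow> (nat \<Rightarrow> real) \<Rightarrow> (nat \<Rightarrow> real) \<Rightarrow> bool" where
  "less_oscillating n v w \<longleftrightarrow>
     (\<forall>f. sublinear_jump_cost f \<longrightarrow> jump_sum f n v \<le> jump_sum f n w) \<and>
     (\<forall>b. (\<forall>i\<in>{1..n}. w i \<le> b) \<longrightarrow> (\<forall>i\<in>{1..n}. v i \<le> b)) \<and>
     (\<forall>b. (\<forall>i\<in>{1..n}. b \<le> w i) \<longrightarrow> (\<forall>i\<in>{1..n}. b \<le> v i))"

lemma less_oscillating_jump_sum:
  "less_oscillating n v w \<Longrightarrow> sublinear_jump_cost f \<Longrightarrow> jump_sum f n v \<le> jump_sum f n w"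
  by (simp add: less_oscillating_def)

lemma less_oscillating_upper:
  "less_oscillating n v w \<Longrightarrow> (\<And>j. j \<in> {1..n} \<Longrightarrow> w j \<le> b) \<Longrightarrow> i \<in> {1..n} \<Longrightarrow> v i \<le> b"
  unfolding less_oscillating_def by blast

lemma less_oscillating_lower:
  "less_oscillating n v w \<Longrightarrow> (\<And>j. j \<in> {1..n} \<Longrightarrow> b \<le> w j) \<Longrightarrow> i \<in> {1..n} \<Longrightarrow> b \<le> v i"
  unfolding less_oscillating_def by blast

lemma less_oscillating_refl: "less_oscillating n v v"
  by (simp add: less_oscillating_def)

lemma less_oscillating_diffusion_step:
  assumes c: "step_weights n c" and vw: "less_oscillating n v w"
  shows "less_oscillating n (diffusion_step c v) w"
  unfolding less_oscillating_def
proof (intro conjI allI impI ballI)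
  show "jump_sum f n (diffusion_step c v) \<le> jump_sum f n w" if "sublinear_jump_cost f" for f
    using diffusion_step_jump_sum[OF c that] less_oscillating_jump_sum[OF vw that] by (rule order_trans)
  show "diffusion_step c v i \<le> b" if "\<forall>i\<in>{1..n}. w i \<le> b" "i \<in> {1..n}" for b i
    using that less_oscillating_upper[OF vw] by (intro diffusion_step_le[OF c]) auto
  show "b \<le> diffusion_step c v i" if "\<forall>i\<in>{1..n}. b \<le> w i" "i \<in> {1..n}" for b i
    using that less_oscillating_lower[OF vw] diffusion_step_mono[OF c, of i "\<lambda>_. b" v]
    by (auto simp: diffusion_step_const)
qed

section \<open>The semi-discrete system as a linear diffusion\<close>

definition semidiscrete_flux :: "(real \<Rightarrow> real) \<Rightarrow> nat \<Rightarrow> (nat \<Rightarrow> real) \<Rightarrow> nat \<Rightarrow> real" where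
  "semidiscrete_flux F n w i =
     D_minus n (\<lambda>j. F (D_plus n (neumann_ext n w) j)) i"

text \<open>The flux has the sign of the gradient, so it always points downhill, and it grows at most
  linearly; together these make the quotient of flux and gradient a bounded nonnegative
  conductivity.\<close>

definition diffusive_flux :: "real \<Rightarrow> (real \<Rightarrow> real) \<Rightarrow> bool" where
  "diffusive_flux C F \<longleftrightarrow> 0 < C \<and> (\<forall>x. F (- x) = - F x) \<and> (\<forall>x\<ge>0. 0 \<le> F x) \<and> (\<forall>x y. \<bar>F x - F y\<bar> \<le> C * \<bar>x - y\<bar>)"

lemma diffusive_flux_0: "diffusive_flux C F \<Longrightarrow> F 0 = 0"
  unfolding diffusive_flux_def by (metis minus_zero neg_equal_zero)

text \<open>The secant slope \<open>F x / x\<close> is the conductivity of the linear diffusion that a given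
  solution satisfies. At \<open>x = 0\<close> the convention \<open>x / 0 = 0\<close> gives an admissible value,
  since the flux vanishes there for every conductivity.\<close>

lemma conductivity_bounds:
  assumes "diffusive_flux C F"
  shows "0 \<le> F x / x" "F x / x \<le> C"
proof -
  have "\<bar>F x - F 0\<bar> \<le> C * \<bar>x - 0\<bar>" using assms unfolding diffusive_flux_def by blast
  then have F: "F (- x) = - F x" "\<And>x. x \<ge> 0 \<Longrightarrow> 0 \<le> F x" "\<bar>F x\<bar> \<le> C * \<bar>x\<bar>" "F 0 = 0" "C > 0"
    using assms diffusive_flux_0[OF assms] by (auto simp: diffusive_flux_def)
  show "0 \<le> F x / x"
    using F(1) F(2)[of x] F(2)[of "-x"] by (cases "x \<ge> 0") (auto simp: divide_nonpos_neg)
  have "F x / x \<le> \<bar>F x\<bar> / \<bar>x\<bar>" using abs_ge_self[of "F x / x"] by simp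
  also have "\<dots> \<le> C" using F(3,4,5) by (cases "x = 0") (auto simp: divide_simps)
  finally show "F x / x \<le> C" .
qed

text \<open>Writing \<open>F (D i) = (F (D i) / D i) * D i\<close> freezes the nonlinearity: an Euler step of the
  nonlinear system started at \<open>w\<close> is a linear diffusion step applied to \<open>w\<close>. The same weights
  can then be applied to any other grid function.\<close>

lemma euler_step_is_diffusion_step:
  assumes F: "diffusive_flux C F" and h: "0 \<le> h" "2 * h * (real n)\<^sup>2 * C \<le> 1"
  obtains c where "step_weights n c"
    "\<And>i. i \<in> {1..n} \<Longrightarrow> w i + h * semidiscrete_flux F n w i = diffusion_step c w i"
proof
  define D where "D = D_plus n (neumann_ext n w)"
  define c where "c i = (if i = 0 \<or> i \<ge> n then 0 else h * (real n)\<^sup>2 * (F (D i) / D i))" for i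
  show "step_weights n c"
  proof -
    have "h * (real n)\<^sup>2 * (F (D i) / D i) \<le> h * (real n)\<^sup>2 * C" for i
      using h conductivity_bounds[OF F] by (intro mult_left_mono) auto
    moreover have "h * (real n)\<^sup>2 * C \<le> 1/2" using h(2) by simp
    ultimately have "h * (real n)\<^sup>2 * (F (D i) / D i) \<le> 1/2" for i
      by (rule order_trans)
    moreover have "0 \<le> h * (real n)\<^sup>2 * (F (D i) / D i)" for i
      using h conductivity_bounds[OF F] by (intro mult_nonneg_nonneg) auto
    ultimately show ?thesis by (auto simp: step_weights_def c_def)
  qed
  fix i assume i: "i \<in> {1..n}"
  have F0: "F 0 = 0" using F by (rule diffusive_flux_0)
  have flux: "h * (real n * F (D j)) = c j * (w (j + 1) - w j)" if "1 \<le> j" "j \<le> n" for j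
  proof (cases "j = n")
    case True
    then show ?thesis using that F0 by (simp add: D_def c_def D_plus_def neumann_ext_def)
  next
    case False
    then have Dj: "D j = real n * (w (j + 1) - w j)"
      using that by (simp add: D_def D_plus_def neumann_ext_def)
    have "F (D j) = F (D j) / D j * D j" using F0 by simp
    then have "h * (real n * F (D j)) = h * (real n * (F (D j) / D j * D j))" by presburger
    also have "\<dots> = h * (real n)\<^sup>2 * (F (D j) / D j) * (w (j + 1) - w j)"
      by (subst (2) Dj) (simp add: power2_eq_square)
    finally show ?thesis using that False by (simp add: c_def)
  qed
  have flux0: "h * (real n * F (D (i - 1))) = c (i - 1) * (w i - w (i - 1))"
  proof (cases "i = 1")
    case True
    then show ?thesis using F0 i by (simp add: D_def c_def D_plus_def neumann_ext_def)
  next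
    case False
    then have "1 \<le> i - 1" "i - 1 \<le> n" "i - 1 + 1 = i" using i by auto
    then show ?thesis using flux[of "i - 1"] by presburger
  qed
  show "w i + h * semidiscrete_flux F n w i = diffusion_step c w i"
    using flux[of i] flux0 i
    by (simp add: semidiscrete_flux_def D_minus_def diffusion_step_def D_def [symmetric] algebra_simps)
qed

lemma semidiscrete_flux_lipschitz:
  assumes F: "diffusive_flux C F" and "i \<in> {1..n}" and le: "\<And>j. j \<in> {1..n} \<Longrightarrow> \<bar>v j - w j\<bar> \<le> e"
  shows "\<bar>semidiscrete_flux F n v i - semidiscrete_flux F n w i\<bar> \<le> 4 * C * (real n)\<^sup>2 * e"
proof -
  have C: "C > 0" "\<bar>F x - F y\<bar> \<le> C * \<bar>x - y\<bar>" for x y using F by (auto simp: diffusive_flux_def)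
  have ext: "\<bar>neumann_ext n v j - neumann_ext n w j\<bar> \<le> e" if "j \<le> n + 1" for j
    using le that assms(2) by (auto simp: neumann_ext_def)
  have D: "\<bar>F (D_plus n (neumann_ext n v) j) - F (D_plus n (neumann_ext n w) j)\<bar> \<le> 2 * C * real n * e"
    if "j \<le> n" for j
  proof -
    have "\<bar>D_plus n (neumann_ext n v) j - D_plus n (neumann_ext n w) j\<bar>
        = real n * \<bar>(neumann_ext n v (j+1) - neumann_ext n w (j+1)) - (neumann_ext n v j - neumann_ext n w j)\<bar>"
      unfolding D_plus_def by (subst abs_of_nonneg[of "real n", symmetric], simp) (simp only: abs_mult [symmetric], simp add: algebra_simps)
    also have "\<dots> \<le> real n * (2 * e)"
      using ext[of j] ext[of "j+1"] that by (intro mult_left_mono) auto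
    finally have "C * \<bar>D_plus n (neumann_ext n v) j - D_plus n (neumann_ext n w) j\<bar> \<le> C * (real n * (2 * e))"
      using C(1) by (intro mult_left_mono) auto
    then show ?thesis using C(2) by (intro order_trans[OF C(2)]) (simp add: mult_ac)
  qed
  have "\<bar>semidiscrete_flux F n v i - semidiscrete_flux F n w i\<bar>
      = real n * \<bar>(F (D_plus n (neumann_ext n v) i) - F (D_plus n (neumann_ext n w) i))
        - (F (D_plus n (neumann_ext n v) (i-1)) - F (D_plus n (neumann_ext n w) (i-1)))\<bar>"
    unfolding semidiscrete_flux_def D_minus_def
    by (subst abs_of_nonneg[of "real n", symmetric], simp) (simp only: abs_mult [symmetric], simp add: algebra_simps)
  also have "\<dots> \<le> real n * (4 * C * real n * e)"
  proof (rule mult_left_mono)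
    have "i \<le> n" "i - 1 \<le> n" using assms(2) by auto
    from D[OF this(1)] D[OF this(2)]
    show "\<bar>(F (D_plus n (neumann_ext n v) i) - F (D_plus n (neumann_ext n w) i))
        - (F (D_plus n (neumann_ext n v) (i-1)) - F (D_plus n (neumann_ext n w) (i-1)))\<bar> \<le> 4 * C * real n * e"
      by linarith
  qed simp
  finally show ?thesis by (simp add: power2_eq_square mult_ac)
qed

definition semidiscrete_solution :: "(real \<Rightarrow> real) \<Rightarrow> nat \<Rightarrow> (real \<Rightarrow> nat \<Rightarrow> real) \<Rightarrow> bool" where
  "semidiscrete_solution F n w \<longleftrightarrow> (\<forall>t\<ge>0. \<forall>i\<in>{1..n}.
     ((\<lambda>s. w s i) has_real_derivative semidiscrete_flux F n (w t) i) (at t within {0..}))"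

text \<open>On a compact time interval the right-hand side of the system is uniformly continuous along
  the solution, so by the mean value theorem the error of an Euler step of length \<open>h\<close> is
  \<open>o(h)\<close> uniformly in the starting time.\<close>

lemma uniform_euler_consistency:
  assumes F: "diffusive_flux C F" and sol: "semidiscrete_solution F n w" and e: "e > 0"
  obtains d where "d > 0"
    "\<And>p h i. \<lbrakk>0 \<le> p; 0 \<le> h; h < d; p + h \<le> T; i \<in> {1..n}\<rbrakk> \<Longrightarrow>
      \<bar>w (p + h) i - (w p i + h * semidiscrete_flux F n (w p) i)\<bar> \<le> h * e"
proof -
  have C: "C > 0" using F by (auto simp: diffusive_flux_def)
  have der: "((\<lambda>s. w s i) has_real_derivative semidiscrete_flux F n (w t) i) (at t within {0..})"
    if "t \<ge> 0" "i \<in> {1..n}" for t i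
    using sol that by (auto simp: semidiscrete_solution_def)
  \<comment> \<open>The right-hand side of the system is Lipschitz with constant \<open>4 * C * n\<^sup>2\<close> in the
    maximum norm, so this oscillation of \<open>w\<close> changes it by at most \<open>e\<close>.\<close>
  define e' where "e' = e / (4 * C * (real n)\<^sup>2 + 1)"
  have "4 * C * (real n)\<^sup>2 + 1 > 0" using C by (intro add_nonneg_pos) auto
  then have e': "e' > 0" "4 * C * (real n)\<^sup>2 * e' \<le> e"
    using e by (auto simp: e'_def divide_simps mult_le_cancel_left_pos algebra_simps)
  have "\<exists>d>0. \<forall>p\<in>{0..T}. \<forall>q\<in>{0..T}. \<bar>q - p\<bar> < d \<longrightarrow> \<bar>w q i - w p i\<bar> < e'" if "i \<in> {1..n}" for i
  proof -
    have "continuous_on {0..T} (\<lambda>s. w s i)"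
      by (intro DERIV_continuous_on[OF DERIV_subset[OF der[OF _ that]]]) auto
    then have "uniformly_continuous_on {0..T} (\<lambda>s. w s i)"
      by (rule compact_uniformly_continuous) auto
    then show ?thesis using e'(1) by (auto simp: uniformly_continuous_on_def dist_real_def)
  qed
  then have "\<forall>i\<in>{1..n}. \<exists>d>0. \<forall>p\<in>{0..T}. \<forall>q\<in>{0..T}. \<bar>q - p\<bar> < d \<longrightarrow> \<bar>w q i - w p i\<bar> < e'"
    by blast
  from bchoice[OF this] obtain d where d: "\<And>i. i \<in> {1..n} \<Longrightarrow> d i > 0"
    "\<And>i p q. \<lbrakk>i \<in> {1..n}; p \<in> {0..T}; q \<in> {0..T}; \<bar>q - p\<bar> < d i\<rbrakk> \<Longrightarrow> \<bar>w q i - w p i\<bar> < e'"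
    by blast
  define D where "D = Min (insert 1 (d ` {1..n}))"
  have D: "D > 0" "\<And>i. i \<in> {1..n} \<Longrightarrow> D \<le> d i"
    using d(1) unfolding D_def by (auto simp del: Min_insert intro!: Min_le)
  show ?thesis
  proof
    show "D > 0" by fact
    fix p h i assume h: "0 \<le> p" "0 \<le> h" "h < D" "p + h \<le> T" and i: "i \<in> {1..n}"
    show "\<bar>w (p + h) i - (w p i + h * semidiscrete_flux F n (w p) i)\<bar> \<le> h * e"
    proof (cases "h = 0")
      case False
      then have "p < p + h" using h by simp
      moreover have "continuous_on {p..p + h} (\<lambda>s. w s i)"
        using h by (intro DERIV_continuous_on[OF DERIV_subset[OF der[OF _ i]]]) auto
      moreover have Dw: "DERIV (\<lambda>s. w s i) x :> semidiscrete_flux F n (w x) i" if "p < x" "x < p + h" for x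
      proof -
        have "at x within {0..} = at x"
          using that h by (intro at_within_interior) auto
        then show ?thesis using der[of x i] i that h by auto
      qed
      ultimately obtain l z where z: "p < z" "z < p + h" "DERIV (\<lambda>s. w s i) z :> l" "w (p + h) i - w p i = (p + h - p) * l"
        using MVT[of p "p + h" "\<lambda>s. w s i"] unfolding real_differentiable_def by blast
      have l: "l = semidiscrete_flux F n (w z) i"
        by (rule DERIV_unique[OF z(3) Dw[OF z(1,2)]])
      have "\<bar>semidiscrete_flux F n (w z) i - semidiscrete_flux F n (w p) i\<bar> \<le> 4 * C * (real n)\<^sup>2 * e'"
      proof (rule semidiscrete_flux_lipschitz[OF F i])
        fix j assume j: "j \<in> {1..n}"
        have "\<bar>z - p\<bar> < d j" using z(1,2) h D(2)[OF j] by linarith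
        moreover have "p \<in> {0..T}" "z \<in> {0..T}" using z(1,2) h by auto
        ultimately show "\<bar>w z j - w p j\<bar> \<le> e'" using d(2)[OF j, of p z] by linarith
      qed
      then have "\<bar>semidiscrete_flux F n (w z) i - semidiscrete_flux F n (w p) i\<bar> \<le> e" using e'(2) by (rule order_trans)
      then have "h * \<bar>l - semidiscrete_flux F n (w p) i\<bar> \<le> h * e"
        unfolding l by (rule mult_left_mono) (rule h)
      moreover have "w (p + h) i - (w p i + h * semidiscrete_flux F n (w p) i) = h * (l - semidiscrete_flux F n (w p) i)"
        using z(4) unfolding add_diff_cancel_left' right_diff_distrib by linarith
      ultimately show ?thesis by (simp only: abs_mult abs_of_nonneg[OF h(2)])
    qed simp
  qed
qed

text \<open>The companion \<open>v\<close> starts from arbitrary data \<open>v0\<close> at time \<open>s\<close> and is moved by the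
  diffusion steps that approximate the solution \<open>w\<close>. As \<open>w\<close> and \<open>v\<close> undergo the same linear steps,
  their \<open>L1\<close> distance grows only through the Euler error of \<open>w\<close>, which is made smaller than
  \<open>e\<close> in total.\<close>

lemma companion_evolution:
  assumes F: "diffusive_flux C F" and sol: "semidiscrete_solution F n w"
    and st: "0 \<le> s" "s \<le> t" and e: "e > 0"
  obtains v where
    "(\<Sum>i=1..n. \<bar>w t i - v i\<bar>) \<le> (\<Sum>i=1..n. \<bar>w s i - v0 i\<bar>) + e"
    "less_oscillating n v v0"
proof -
  have C: "C > 0" using F by (auto simp: diffusive_flux_def)
  define e' where "e' = e / (real n * (t - s) + 1)"
  have pos: "real n * (t - s) + 1 > 0" using st by (intro add_nonneg_pos) auto
  have e': "e' > 0" "real n * (t - s) * e' \<le> e"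
    using e pos by (auto simp: e'_def field_simps)
  obtain d where d: "d > 0"
    "\<And>p h i. \<lbrakk>0 \<le> p; 0 \<le> h; h < d; p + h \<le> t; i \<in> {1..n}\<rbrakk> \<Longrightarrow>
      \<bar>w (p + h) i - (w p i + h * semidiscrete_flux F n (w p) i)\<bar> \<le> h * e'"
    using uniform_euler_consistency[OF F sol e'(1)] by blast
  define K where "K = 2 * (real n)\<^sup>2 * C"
  have K: "K \<ge> 0" using C by (simp add: K_def)
  \<comment> \<open>The first summand ensures the stability of the steps of length \<open>(t - s) / N\<close>, the second
    one their consistency.\<close>
  obtain N :: nat where N: "real N > (t - s) * K + (t - s) / d" "N > 0"
  proof -
    obtain N :: nat where "real N > (t - s) * K + (t - s) / d" using reals_Archimedean2 by blast
    moreover have "(t - s) * K + (t - s) / d \<ge> 0" using st K d(1) by (intro add_nonneg_nonneg) auto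
    ultimately show ?thesis using that[of N] by auto
  qed
  define h where "h = (t - s) / real N"
  have h0: "0 \<le> h" "real N * h = t - s" using st N by (auto simp: h_def)
  have hK: "2 * h * (real n)\<^sup>2 * C \<le> 1"
  proof -
    have "0 \<le> (t - s) / d" using st d(1) by simp
    then have "(t - s) * K \<le> real N" using N(1) by linarith
    then have "h * K \<le> 1" using N(2) by (simp add: h_def field_simps)
    then show ?thesis by (simp add: K_def mult_ac)
  qed
  have hd: "h < d"
  proof -
    have "0 \<le> (t - s) * K" using st K by simp
    then have "(t - s) / d < real N" using N(1) by linarith
    then show ?thesis using N(2) d(1) by (simp add: h_def field_simps)
  qed
  have "\<exists>v. (\<Sum>i=1..n. \<bar>w (s + real k * h) i - v i\<bar>) \<le> (\<Sum>i=1..n. \<bar>w s i - v0 i\<bar>) + real k * (real n * (h * e')) \<and>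
     less_oscillating n v v0" if "k \<le> N" for k
    using that
  proof (induction k)
    case 0
    show ?case by (intro exI[of _ v0]) (simp add: less_oscillating_refl)
  next
    case (Suc k)
    then obtain v where v1: "(\<Sum>i=1..n. \<bar>w (s + real k * h) i - v i\<bar>) \<le> (\<Sum>i=1..n. \<bar>w s i - v0 i\<bar>) + real k * (real n * (h * e'))"
     and v2: "less_oscillating n v v0" by auto
    define p where "p = s + real k * h"
    have "real (Suc k) * h \<le> real N * h" using Suc.prems h0 by (intro mult_right_mono) auto
    then have p: "0 \<le> p" "p + h \<le> t" "s + real (Suc k) * h = p + h"
      using st h0 by (auto simp: p_def algebra_simps)
    obtain c where c: "step_weights n c"
      "\<And>i. i \<in> {1..n} \<Longrightarrow> w p i + h * semidiscrete_flux F n (w p) i = diffusion_step c (w p) i"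
      using euler_step_is_diffusion_step[OF F h0(1) hK] by blast
    let ?v = "diffusion_step c v"
    have "(\<Sum>i=1..n. \<bar>w (p + h) i - ?v i\<bar>) \<le> (\<Sum>i=1..n. h * e' + \<bar>diffusion_step c (\<lambda>j. w p j - v j) i\<bar>)"
    proof (rule sum_mono)
      fix i assume i: "i \<in> {1..n}"
      show "\<bar>w (p + h) i - ?v i\<bar> \<le> h * e' + \<bar>diffusion_step c (\<lambda>j. w p j - v j) i\<bar>"
        using d(2)[OF p(1) h0(1) hd p(2) i] c(2)[OF i] diffusion_step_diff[of c "w p" i v] by linarith
    qed
    also have "\<dots> = real n * (h * e') + (\<Sum>i=1..n. \<bar>diffusion_step c (\<lambda>j. w p j - v j) i\<bar>)"
      by (simp add: sum.distrib)
    also have "\<dots> \<le> real n * (h * e') + (\<Sum>i=1..n. \<bar>w p i - v i\<bar>)"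
      using diffusion_step_l1_contraction[OF c(1), of "\<lambda>j. w p j - v j"] by simp
    finally have 1: "(\<Sum>i=1..n. \<bar>w (s + real (Suc k) * h) i - ?v i\<bar>)
       \<le> (\<Sum>i=1..n. \<bar>w s i - v0 i\<bar>) + real (Suc k) * (real n * (h * e'))"
      using v1 unfolding p(3) p_def[symmetric] by (simp add: algebra_simps)
    show ?case using 1 less_oscillating_diffusion_step[OF c(1) v2] by blast
  qed
  from this[of N] obtain v where v: "(\<Sum>i=1..n. \<bar>w t i - v i\<bar>) \<le> (\<Sum>i=1..n. \<bar>w s i - v0 i\<bar>) + real N * (real n * (h * e'))"
     "less_oscillating n v v0"
    using h0(2) by auto
  have "real N * (real n * (h * e')) = real n * (real N * h) * e'" by (simp add: mult_ac)
  then have "real N * (real n * (h * e')) \<le> e" unfolding h0(2) using e'(2) by linarith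
  then have "(\<Sum>i=1..n. \<bar>w t i - v i\<bar>) \<le> (\<Sum>i=1..n. \<bar>w s i - v0 i\<bar>) + e" using v(1) by linarith
  then show ?thesis using v(2) by (rule that)
qed

text \<open>Nonnegativity of \<open>\<phi>'\<close> on the half line follows from \<open>\<phi>' 0 = 0\<close> on the part where \<open>\<phi>'\<close>
  increases, and from the limit \<open>0\<close> at infinity on the part where it decreases.\<close>

lemma perona_malik_diffusive_flux:
  assumes "perona_malik_nonlinearity \<phi>"
  obtains C where "diffusive_flux C (deriv \<phi>)"
proof -
  have even: "\<phi> (- s) = \<phi> s" and diff: "\<phi> differentiable (at s)"
    and diff2: "deriv \<phi> differentiable (at s)" for s
    using assms by (auto simp: perona_malik_nonlinearity_def)
  have lim: "(deriv \<phi> \<longlongrightarrow> 0) at_top" using assms by (auto simp: perona_malik_nonlinearity_def)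
  have D1: "(\<phi> has_real_derivative deriv \<phi> s) (at s)" for s
    using diff[of s] DERIV_deriv_iff_real_differentiable by blast
  have D2: "(deriv \<phi> has_real_derivative deriv (deriv \<phi>) s) (at s)" for s
    using diff2[of s] DERIV_deriv_iff_real_differentiable by blast
  have odd: "deriv \<phi> (- s) = - deriv \<phi> s" for s
  proof -
    have "((\<lambda>x. \<phi> (- x)) has_real_derivative deriv \<phi> (- s) * (- 1)) (at s)"
      by (rule DERIV_chain2[OF D1]) (auto intro!: derivative_eq_intros)
    then have "(\<phi> has_real_derivative deriv \<phi> (- s) * (- 1)) (at s)" by (simp add: even)
    then show ?thesis using D1[of s] DERIV_unique by fastforce
  qed
  obtain C where C: "\<bar>deriv (deriv \<phi>) s\<bar> \<le> C" for s
    using assms by (auto simp: perona_malik_nonlinearity_def bounded_iff)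
  have lip: "\<bar>deriv \<phi> x - deriv \<phi> y\<bar> \<le> C * \<bar>x - y\<bar>" for x y
  proof -
    have "norm (deriv \<phi> x - deriv \<phi> y) \<le> C * norm (x - y)"
      by (rule field_differentiable_bound[of UNIV _ "deriv (deriv \<phi>)"]) (use D2 C in simp_all)
    then show ?thesis by simp
  qed
  obtain \<sigma> where \<sigma>: "\<sigma> > 0" "mono_on {0..\<sigma>} (deriv \<phi>)" "antimono_on {\<sigma>..} (deriv \<phi>)"
    using assms unfolding perona_malik_nonlinearity_def by blast
  have nonneg: "0 \<le> deriv \<phi> x" if "x \<ge> 0" for x
  proof (cases "x \<le> \<sigma>")
    case True
    have "deriv \<phi> 0 = 0" using odd[of 0] by simp
    moreover have "deriv \<phi> 0 \<le> deriv \<phi> x"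
      by (rule monotone_onD[OF \<sigma>(2)]) (use that True \<sigma>(1) in auto)
    ultimately show ?thesis by simp
  next
    case False
    have "deriv \<phi> y \<le> deriv \<phi> x" if "x \<le> y" for y
      using monotone_onD[OF \<sigma>(3), of x y] that False by simp
    then have "eventually (\<lambda>y. deriv \<phi> y \<le> deriv \<phi> x) at_top"
      by (rule eventually_mono[OF eventually_ge_at_top[of x]])
    then show ?thesis by (rule tendsto_upperbound[OF lim]) simp
  qed
  have "C \<ge> 0" using C[of 0] by linarith
  have "C * \<bar>x - y\<bar> \<le> (C + 1) * \<bar>x - y\<bar>" for x y by (intro mult_right_mono) auto
  then have "\<bar>deriv \<phi> x - deriv \<phi> y\<bar> \<le> (C + 1) * \<bar>x - y\<bar>" for x y using lip order_trans by blast
  then have "diffusive_flux (C + 1) (deriv \<phi>)"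
    using odd nonneg \<open>C \<ge> 0\<close> by (auto simp: diffusive_flux_def)
  then show ?thesis by (rule that)
qed

section \<open>Step functions and convergence in the mean\<close>

definition grid_step :: "nat \<Rightarrow> (nat \<Rightarrow> real) \<Rightarrow> real \<Rightarrow> real" where
  "grid_step n w x = w (nat \<lceil>real n * x\<rceil>)"

lemma grid_index_in_range:
  assumes "0 < n" "x \<in> {0<..<1}"
  shows "nat \<lceil>real n * x\<rceil> \<in> {1..n}"
proof -
  have "0 < real n * x" "real n * x \<le> real n" using assms by auto
  then have "0 < \<lceil>real n * x\<rceil>" "\<lceil>real n * x\<rceil> \<le> int n"
    unfolding zero_less_ceiling ceiling_le_iff of_int_of_nat_eq by blast+
  then show ?thesis by (simp add: Suc_le_eq nat_le_iff del: zero_less_ceiling ceiling_le_iff)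
qed

lemma measure_grid_cell:
  assumes "i \<in> {1..n}"
  shows "measure (lebesgue_on {0<..<1}) ({(real i - 1) / real n<..real i / real n} \<inter> {0<..<1}) = 1 / real n"
proof -
  have n: "real n > 0" using assms by auto
  have eq: "{(real i - 1) / real n<..real i / real n} \<inter> {0<..<1} =
    (if i = n then {(real i - 1) / real n<..<real i / real n} else {(real i - 1) / real n<..real i / real n})"
  proof -
    have 1: "0 \<le> (real i - 1) / real n" using assms n by (intro divide_nonneg_pos) auto
    have 2: "i \<noteq> n \<Longrightarrow> real i / real n < 1" "i = n \<Longrightarrow> real i / real n = 1" using assms n by auto
    show ?thesis
    proof (cases "i = n")
      case True
      have "0 < x" if "(real i - 1) / real n < x" for x using 1 that by (rule le_less_trans)
      then show ?thesis unfolding set_eq_iff using 2(2)[OF True] True by (auto simp del: divide_self_if)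
    next
      case False
      show ?thesis unfolding set_eq_iff using 1 2(1)[OF False] False by (auto simp del: divide_less_eq_1)
    qed
  qed
  have "measure (lebesgue_on {0<..<1}) ({(real i - 1) / real n<..real i / real n} \<inter> {0<..<1})
      = measure lebesgue ({(real i - 1) / real n<..real i / real n} \<inter> {0<..<1})"
    by (rule measure_restrict_space) auto
  also have "\<dots> = 1 / real n"
  proof -
    have "(real i - 1) / real n \<le> real i / real n" using n by (simp add: divide_right_mono)
    then show ?thesis unfolding eq by (simp add: diff_divide_distrib)
  qed
  finally show ?thesis .
qed

lemma has_integral_grid_step:
  assumes "0 < n"
  shows "has_bochner_integral unit_interval_measure (grid_step n w) ((\<Sum>i=1..n. w i) / real n)"
proof -
  define A where "A i = {(real i - 1) / real n<..real i / real n} \<inter> {0<..<1::real}" for i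
  have A: "A i \<in> sets unit_interval_measure" for i
    by (auto simp: A_def sets_restrict_space)
  have fin: "finite_measure unit_interval_measure"
    by (rule finite_measureI) (simp add: emeasure_restrict_space)
  have "has_bochner_integral unit_interval_measure (indicator (A i) :: real \<Rightarrow> real) (1 / real n)"
    if "i \<in> {1..n}" for i
  proof -
    have "has_bochner_integral unit_interval_measure (indicator (A i) :: real \<Rightarrow> real) (measure unit_interval_measure (A i))"
      using A finite_measure.emeasure_finite[OF fin]
      by (intro has_bochner_integral_real_indicator) (auto simp: less_top)
    then show ?thesis using measure_grid_cell[OF that] by (simp add: A_def)
  qed
  then have "has_bochner_integral unit_interval_measure (\<lambda>x. \<Sum>i=1..n. w i * indicator (A i) x) (\<Sum>i=1..n. w i * (1 / real n))"
    by (intro has_bochner_integral_sum has_bochner_integral_mult_right) auto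
  moreover have "(\<Sum>i=1..n. w i * indicator (A i) x) = grid_step n w x" if "x \<in> {0<..<1}" for x
  proof -
    define j where "j = nat \<lceil>real n * x\<rceil>"
    have j: "j \<in> {1..n}" unfolding j_def by (rule grid_index_in_range) fact+
    have "x \<in> A i \<longleftrightarrow> i = j" if "i \<in> {1..n}" for i
    proof -
      have "x \<in> A i \<longleftrightarrow> real i - 1 < real n * x \<and> real n * x \<le> real i"
        using assms \<open>x \<in> {0<..<1}\<close> by (auto simp: A_def field_simps)
      also have "\<dots> \<longleftrightarrow> \<lceil>real n * x\<rceil> = int i"
        by (simp add: ceiling_eq_iff)
      also have "\<dots> \<longleftrightarrow> i = j" using j that by (auto simp: j_def)
      finally show ?thesis .
    qed
    then have "(\<Sum>i=1..n. w i * indicator (A i) x) = (\<Sum>i=1..n. if i = j then w i else 0)"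
      by (intro sum.cong) (auto simp: indicator_def)
    then show ?thesis using j by (simp add: grid_step_def j_def)
  qed
  ultimately show ?thesis
    by (subst (asm) has_bochner_integral_cong[where g = "grid_step n w"])
       (auto simp: sum_divide_distrib)
qed

lemma integrable_grid_step: "0 < n \<Longrightarrow> integrable unit_interval_measure (grid_step n w)"
  and integral_grid_step: "0 < n \<Longrightarrow> (LINT x|unit_interval_measure. grid_step n w x) = (\<Sum>i=1..n. w i) / real n"
  using has_integral_grid_step[of n w] by (auto simp: has_bochner_integral_iff)

lemma integral_abs_grid_step_diff:
  assumes "0 < n"
  shows "(LINT x|unit_interval_measure. \<bar>grid_step n v x - grid_step n w x\<bar>) = (\<Sum>i=1..n. \<bar>v i - w i\<bar>) / real n"
  using integral_grid_step[OF assms, of "\<lambda>i. \<bar>v i - w i\<bar>"] by (simp add: grid_step_def)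

definition grid_l1_tendsto :: "(nat \<Rightarrow> nat) \<Rightarrow> (nat \<Rightarrow> nat \<Rightarrow> real) \<Rightarrow> (real \<Rightarrow> real) \<Rightarrow> bool" where
  "grid_l1_tendsto n V f \<longleftrightarrow>
     (\<lambda>k. LINT x|unit_interval_measure. \<bar>grid_step (n k) (V k) x - f x\<bar>) \<longlonglongrightarrow> 0"

lemma prob_space_unit_interval: "prob_space unit_interval_measure"
  by (rule prob_space_restrict_space) auto

lemma in_L2_integrable:
  assumes "in_L2 f"
  shows "integrable unit_interval_measure f"
proof -
  interpret prob_space unit_interval_measure by (rule prob_space_unit_interval)
  have [measurable]: "f \<in> borel_measurable unit_interval_measure" using assms by (simp add: in_L2_def)
  show ?thesis
  proof (rule Bochner_Integration.integrable_bound[of _ "\<lambda>x. 1 + (f x)\<^sup>2"])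
    show "integrable unit_interval_measure (\<lambda>x. 1 + (f x)\<^sup>2)"
      using assms by (intro Bochner_Integration.integrable_add) (auto simp: in_L2_def)
    have "\<bar>y\<bar> \<le> 1 + y\<^sup>2" for y :: real
      using zero_le_power2[of "\<bar>y\<bar> - 1"] zero_le_power2[of y] by (simp add: power2_diff)
    then show "AE x in unit_interval_measure. norm (f x) \<le> norm (1 + (f x)\<^sup>2)"
      by (auto intro!: AE_I2 simp: abs_of_nonneg add_nonneg_nonneg)
  qed simp
qed

lemma in_L2_diff:
  assumes "in_L2 f" "in_L2 g"
  shows "in_L2 (\<lambda>x. f x - g x)"
proof -
  have [measurable]: "f \<in> borel_measurable unit_interval_measure" "g \<in> borel_measurable unit_interval_measure"
    using assms by (simp_all add: in_L2_def)
  have "integrable unit_interval_measure (\<lambda>x. (f x - g x)\<^sup>2)"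
  proof (rule Bochner_Integration.integrable_bound[of _ "\<lambda>x. 2 * (f x)\<^sup>2 + 2 * (g x)\<^sup>2"])
    show "integrable unit_interval_measure (\<lambda>x. 2 * (f x)\<^sup>2 + 2 * (g x)\<^sup>2)"
      using assms by (auto simp: in_L2_def)
    have "(a - b)\<^sup>2 \<le> 2 * a\<^sup>2 + 2 * b\<^sup>2" for a b :: real
      using zero_le_power2[of "a + b"] by (simp add: power2_diff power2_sum)
    then show "AE x in unit_interval_measure. norm ((f x - g x)\<^sup>2) \<le> norm (2 * (f x)\<^sup>2 + 2 * (g x)\<^sup>2)"
      by (auto intro!: AE_I2 simp: abs_of_nonneg add_nonneg_nonneg)
  qed simp
  then show ?thesis by (simp add: in_L2_def)
qed

lemma integral_abs_le_L2_norm: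
  assumes "in_L2 f"
  shows "(LINT x|unit_interval_measure. \<bar>f x\<bar>) \<le> L2_norm f"
proof -
  interpret prob_space unit_interval_measure by (rule prob_space_unit_interval)
  \<comment> \<open>The variance of \<open>\<bar>f\<bar>\<close> is nonnegative.\<close>
  define c where "c = (LINT x|unit_interval_measure. \<bar>f x\<bar>)"
  have int: "integrable unit_interval_measure (\<lambda>x. \<bar>f x\<bar>)" "integrable unit_interval_measure (\<lambda>x. (f x)\<^sup>2)"
    using in_L2_integrable[OF assms] assms by (auto simp: in_L2_def)
  have "0 \<le> (LINT x|unit_interval_measure. (\<bar>f x\<bar> - c)\<^sup>2)" by (rule Bochner_Integration.integral_nonneg) simp
  also have "\<dots> = (LINT x|unit_interval_measure. (f x)\<^sup>2 + (c\<^sup>2 - 2 * c * \<bar>f x\<bar>))"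
    by (rule Bochner_Integration.integral_cong) (auto simp: power2_diff)
  also have "\<dots> = (LINT x|unit_interval_measure. (f x)\<^sup>2) + (c\<^sup>2 - 2 * c * c)"
    using int prob_space
    by (subst Bochner_Integration.integral_add) (auto simp: Bochner_Integration.integral_diff c_def)
  finally have "c\<^sup>2 \<le> (LINT x|unit_interval_measure. (f x)\<^sup>2)" by (simp add: power2_eq_square)
  then show ?thesis unfolding L2_norm_def c_def[symmetric] by (rule real_le_rsqrt)
qed

lemma grid_step_in_L2: "0 < n \<Longrightarrow> in_L2 (grid_step n w)"
  using borel_measurable_integrable[OF integrable_grid_step[of n w]] integrable_grid_step[of n "\<lambda>i. (w i)\<^sup>2"]
  unfolding in_L2_def grid_step_def by blast

lemma grid_l1_tendsto_uminus:
  assumes "grid_l1_tendsto n V f"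
  shows "grid_l1_tendsto n (\<lambda>k i. - V k i) (\<lambda>x. - f x)"
proof -
  have "\<bar>- a - - b\<bar> = \<bar>a - b\<bar>" for a b :: real by simp
  then show ?thesis using assms by (simp add: grid_l1_tendsto_def grid_step_def)
qed

section \<open>Passage to the limit for companions\<close>

text \<open>Approximation in \<open>L1\<close> at each single time, a mode of convergence that suits both the
  contraction property of diffusion steps and the extraction of almost everywhere
  convergent subsequences.\<close>

locale semidiscrete_approximation =
  fixes C :: real and F :: "real \<Rightarrow> real" and n :: "nat \<Rightarrow> nat"
    and U :: "nat \<Rightarrow> real \<Rightarrow> nat \<Rightarrow> real" and u :: "real \<Rightarrow> real \<Rightarrow> real" and B :: real
  assumes flux: "diffusive_flux C F"
    and n_mono: "strict_mono n" and n_pos: "\<And>k. 0 < n k"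
    and solves: "\<And>k. semidiscrete_solution F (n k) (U k)"
    and converges: "\<And>t. 0 \<le> t \<Longrightarrow> grid_l1_tendsto n (\<lambda>k. U k t) (u t)"
    and integrable_u: "\<And>t. 0 \<le> t \<Longrightarrow> integrable unit_interval_measure (u t)"
    and initial_bound: "\<And>k i. i \<in> {1..n k} \<Longrightarrow> \<bar>U k 0 i\<bar> \<le> B"
    and initial_jumps: "\<And>k. jump_sum abs (n k) (U k 0) \<le> B"

lemma generalized_solution_approximation:
  assumes \<phi>: "perona_malik_nonlinearity \<phi>" and u: "generalized_solution \<phi> u"
  obtains C n U B where "semidiscrete_approximation C (deriv \<phi>) n U u B"
proof -
  obtain C where C: "diffusive_flux C (deriv \<phi>)" using perona_malik_diffusive_flux[OF \<phi>] .
  obtain n U M where n: "strict_mono n" "\<And>k. n k > 0"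
    and M: "\<And>k. discrete_sup_norm (n k) (U k 0) + discrete_TV (n k) (U k 0) \<le> M"
    and sol: "\<forall>k. \<forall>t\<ge>0. \<forall>i\<in>{1..n k}.
           ((\<lambda>s. U k s i) has_real_derivative
              D_minus (n k) (\<lambda>j. deriv \<phi> (D_plus (n k) (neumann_ext (n k) (U k t)) j)) i)
           (at t within {0..})"
    and conv: "\<forall>T>0. (\<lambda>k. SUP t\<in>{0..T}.
             ereal (L2_norm (\<lambda>x. U k t (nat \<lceil>real (n k) * x\<rceil>) - u t x))) \<longlonglongrightarrow> 0"
    using u unfolding generalized_solution_def by blast
  have L2: "in_L2 (u t)" if "0 \<le> t" for t
    using u that by (auto simp: generalized_solution_def continuous_into_L2_def)
  have sup: "\<bar>U k 0 i\<bar> \<le> discrete_sup_norm (n k) (U k 0)" if "i \<in> {1..n k}" for k i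
    unfolding discrete_sup_norm_def using that by (intro Max_ge) auto
  have TV: "discrete_TV (n k) (U k 0) = jump_sum abs (n k) (U k 0)" for k
    by (simp add: discrete_TV_def jump_sum_def)
  have TV0: "0 \<le> jump_sum abs (n k) (U k 0)" for k
    by (auto simp: jump_sum_def intro: sum_nonneg)
  have sup0: "0 \<le> discrete_sup_norm (n k) (U k 0)" for k
    using sup[of 1 k] n(2)[of k] by (smt (verit) One_nat_def Suc_leI atLeastAtMost_iff order_refl)
  show ?thesis
  proof (rule that[of C n U M], unfold_locales)
    show "semidiscrete_solution (deriv \<phi>) (n k) (U k)" for k
      using sol by (simp add: semidiscrete_solution_def semidiscrete_flux_def)
    show "\<bar>U k 0 i\<bar> \<le> M" if "i \<in> {1..n k}" for k i
      using sup[OF that] M[of k] TV0[of k] TV by (smt (verit))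
    show "jump_sum abs (n k) (U k 0) \<le> M" for k using M[of k] sup0[of k] TV by (smt (verit))
    fix t :: real assume t: "0 \<le> t"
    show "integrable unit_interval_measure (u t)" by (intro in_L2_integrable L2 t)
    define e where "e k = (SUP t\<in>{0..t + 1}. ereal (L2_norm (\<lambda>x. U k t (nat \<lceil>real (n k) * x\<rceil>) - u t x)))" for k
    have "e \<longlonglongrightarrow> 0" using conv t unfolding e_def by simp
    have le: "(LINT x|unit_interval_measure. \<bar>grid_step (n k) (U k t) x - u t x\<bar>) \<le> e k" for k
    proof -
      have "in_L2 (\<lambda>x. grid_step (n k) (U k t) x - u t x)"
        by (intro in_L2_diff grid_step_in_L2 L2 n t)
      from integral_abs_le_L2_norm[OF this]
      have "ereal (LINT x|unit_interval_measure. \<bar>grid_step (n k) (U k t) x - u t x\<bar>)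
         \<le> ereal (L2_norm (\<lambda>x. U k t (nat \<lceil>real (n k) * x\<rceil>) - u t x))"
        by (simp add: grid_step_def)
      also have "\<dots> \<le> e k" unfolding e_def by (rule SUP_upper) (use t in auto)
      finally show ?thesis .
    qed
    have "(\<lambda>k. ereal (LINT x|unit_interval_measure. \<bar>grid_step (n k) (U k t) x - u t x\<bar>)) \<longlonglongrightarrow> ereal 0"
      unfolding zero_ereal_def[symmetric]
      by (rule tendsto_sandwich[OF _ _ tendsto_const \<open>e \<longlonglongrightarrow> 0\<close>])
         (auto simp: le intro!: always_eventually)
    then show "grid_l1_tendsto n (\<lambda>k. U k t) (u t)" by (simp add: grid_l1_tendsto_def)
  qed (use C n in auto)
qed

lemma neumann_ext_uminus: "neumann_ext n (\<lambda>i. - w i) j = - neumann_ext n w j"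
  by (simp add: neumann_ext_def)

lemma semidiscrete_flux_uminus:
  assumes "diffusive_flux C F"
  shows "semidiscrete_flux F n (\<lambda>i. - w i) i = - semidiscrete_flux F n w i"
proof -
  have F: "F (- x) = - F x" for x using assms by (simp add: diffusive_flux_def)
  have "D_plus n (neumann_ext n (\<lambda>i. - w i)) j = - D_plus n (neumann_ext n w) j" for j
    by (simp add: D_plus_def neumann_ext_uminus algebra_simps)
  then show ?thesis by (simp add: semidiscrete_flux_def D_minus_def F algebra_simps)
qed

text \<open>Oddness of the flux makes the problem invariant under \<open>u \<mapsto> -u\<close>; this reduces the essential
  infimum and the negative variation to the essential supremum and the positive variation.\<close>

lemma (in semidiscrete_approximation) negated_approximation:
  "semidiscrete_approximation C F n (\<lambda>k t i. - U k t i) (\<lambda>t x. - u t x) B"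
proof
  show "semidiscrete_solution F (n k) (\<lambda>t i. - U k t i)" for k
    using solves[of k] unfolding semidiscrete_solution_def semidiscrete_flux_uminus[OF flux]
    by (auto intro: DERIV_minus)
  show "grid_l1_tendsto n (\<lambda>k i. - U k t i) (\<lambda>x. - u t x)" if "0 \<le> t" for t
    by (rule grid_l1_tendsto_uminus[OF converges[OF that]])
  show "jump_sum abs (n k) (\<lambda>i. - U k 0 i) \<le> B" for k
  proof -
    have "\<bar>- a - - b\<bar> = \<bar>a - b\<bar>" for a b :: real by simp
    then show ?thesis using initial_jumps[of k] by (simp add: jump_sum_def)
  qed
qed (use flux n_mono n_pos integrable_u initial_bound in auto)

text \<open>The \<open>L1\<close> contraction makes the companions of \<open>U k\<close> converge to \<open>u t\<close> as soon as their data
  at time \<open>s\<close> converge to \<open>u s\<close>. So the approximations \<open>U k s\<close>, which may oscillate more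
  than their limit, can be replaced by approximations of \<open>u s\<close> that do not. An error of size
  \<open>1\<close> in the unweighted sums is harmless, because integration divides it by \<open>n k\<close>.\<close>

lemma (in semidiscrete_approximation) companion_limit:
  assumes st: "0 \<le> s" "s \<le> t" and W: "grid_l1_tendsto n W (u s)"
  obtains V where "grid_l1_tendsto n V (u t)"
    "\<And>k. less_oscillating (n k) (V k) (W k)"
proof -
  have "\<exists>V. \<forall>k. (\<Sum>i=1..n k. \<bar>U k t i - V k i\<bar>) \<le> (\<Sum>i=1..n k. \<bar>U k s i - W k i\<bar>) + 1 \<and>
    less_oscillating (n k) (V k) (W k)"
  proof (intro choice allI)
    fix k
    show "\<exists>v. (\<Sum>i=1..n k. \<bar>U k t i - v i\<bar>) \<le> (\<Sum>i=1..n k. \<bar>U k s i - W k i\<bar>) + 1 \<and>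
      less_oscillating (n k) v (W k)"
      by (rule companion_evolution[OF flux solves[of k] st zero_less_one, of "W k"]) blast
  qed
  then obtain V where
    V1: "\<And>k. (\<Sum>i=1..n k. \<bar>U k t i - V k i\<bar>) \<le> (\<Sum>i=1..n k. \<bar>U k s i - W k i\<bar>) + 1"
    and V2: "\<And>k. less_oscillating (n k) (V k) (W k)"
    by blast
  let ?I = "\<lambda>f. LINT x|unit_interval_measure. f x"
  let ?S = "\<lambda>k w x. grid_step (n k) w x"
  note [simp] = integrable_grid_step[OF n_pos] integrable_u
  have t: "0 \<le> t" using st by simp
  have tri: "?I (\<lambda>x. \<bar>f x - g x\<bar>) \<le> ?I (\<lambda>x. \<bar>f x - h x\<bar>) + ?I (\<lambda>x. \<bar>g x - h x\<bar>)"
    if "integrable unit_interval_measure f" "integrable unit_interval_measure g" "integrable unit_interval_measure h"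
    for f g h :: "real \<Rightarrow> real"
  proof -
    have "?I (\<lambda>x. \<bar>f x - g x\<bar>) \<le> ?I (\<lambda>x. \<bar>f x - h x\<bar> + \<bar>g x - h x\<bar>)"
      using that by (intro integral_mono) auto
    then show ?thesis using that by simp
  qed
  have bound: "?I (\<lambda>x. \<bar>?S k (V k) x - u t x\<bar>) \<le>
      ?I (\<lambda>x. \<bar>?S k (U k s) x - u s x\<bar>) + ?I (\<lambda>x. \<bar>?S k (W k) x - u s x\<bar>) + 1 / real (n k)
      + ?I (\<lambda>x. \<bar>?S k (U k t) x - u t x\<bar>)" for k
  proof -
    have "?I (\<lambda>x. \<bar>?S k (V k) x - u t x\<bar>)
        \<le> ?I (\<lambda>x. \<bar>?S k (V k) x - ?S k (U k t) x\<bar>) + ?I (\<lambda>x. \<bar>u t x - ?S k (U k t) x\<bar>)"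
      using t by (intro tri) auto
    also have "?I (\<lambda>x. \<bar>u t x - ?S k (U k t) x\<bar>) = ?I (\<lambda>x. \<bar>?S k (U k t) x - u t x\<bar>)"
      by (simp add: abs_minus_commute)
    also have "?I (\<lambda>x. \<bar>?S k (V k) x - ?S k (U k t) x\<bar>) = (\<Sum>i=1..n k. \<bar>U k t i - V k i\<bar>) / real (n k)"
      by (subst integral_abs_grid_step_diff[OF n_pos]) (simp add: abs_minus_commute)
    also have "\<dots> \<le> ((\<Sum>i=1..n k. \<bar>U k s i - W k i\<bar>) + 1) / real (n k)"
      using V1[of k] by (rule divide_right_mono) simp
    also have "\<dots> = ?I (\<lambda>x. \<bar>?S k (U k s) x - ?S k (W k) x\<bar>) + 1 / real (n k)"
      by (subst integral_abs_grid_step_diff[OF n_pos]) (simp add: add_divide_distrib)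
    also have "?I (\<lambda>x. \<bar>?S k (U k s) x - ?S k (W k) x\<bar>)
        \<le> ?I (\<lambda>x. \<bar>?S k (U k s) x - u s x\<bar>) + ?I (\<lambda>x. \<bar>?S k (W k) x - u s x\<bar>)"
      using st by (intro tri) auto
    finally show ?thesis by simp
  qed
  have lim: "(\<lambda>k. ?I (\<lambda>x. \<bar>?S k (U k s) x - u s x\<bar>) + ?I (\<lambda>x. \<bar>?S k (W k) x - u s x\<bar>) + 1 / real (n k)
      + ?I (\<lambda>x. \<bar>?S k (U k t) x - u t x\<bar>)) \<longlonglongrightarrow> 0 + 0 + 0 + 0"
  proof (intro tendsto_add)
    have "filterlim (\<lambda>k. real (n k)) at_top sequentially"
      using filterlim_compose[OF filterlim_real_sequentially filterlim_subseq[OF n_mono]] .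
    then show "(\<lambda>k. 1 / real (n k)) \<longlonglongrightarrow> 0"
      by (rule real_tendsto_divide_at_top[OF tendsto_const])
  qed (use converges[OF st(1)] converges[OF t] W in \<open>auto simp: grid_l1_tendsto_def\<close>)
  have "grid_l1_tendsto n V (u t)"
    unfolding grid_l1_tendsto_def
    by (rule tendsto_sandwich[OF _ _ tendsto_const lim[simplified]]) (auto intro!: always_eventually bound)
  then show ?thesis using V2 by (rule that)
qed

section \<open>Almost everywhere bounds and lower semicontinuity\<close>

lemma grid_l1_AE_subseq:
  assumes "\<And>k. 0 < n k" "integrable unit_interval_measure f" "grid_l1_tendsto n V f"
  obtains r where "strict_mono r"
    "AE x in unit_interval_measure. (\<lambda>k. grid_step (n (r k)) (V (r k)) x) \<longlonglongrightarrow> f x"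
proof -
  have "\<exists>r::nat\<Rightarrow>nat. strict_mono r \<and>
      (AE x in unit_interval_measure. (\<lambda>k. grid_step (n (r k)) (V (r k)) x - f x) \<longlonglongrightarrow> 0)"
    using assms by (intro tendsto_L1_AE_subseq) (auto simp: integrable_grid_step grid_l1_tendsto_def)
  then show ?thesis using that by (auto simp: LIM_zero_iff)
qed

lemma grid_l1_limit_AE_le:
  assumes "\<And>k. 0 < n k" "integrable unit_interval_measure f" "grid_l1_tendsto n V f"
    and le: "\<And>k i. i \<in> {1..n k} \<Longrightarrow> V k i \<le> b"
  shows "AE x in unit_interval_measure. f x \<le> b"
proof -
  obtain r where r: "strict_mono r"
    "AE x in unit_interval_measure. (\<lambda>k. grid_step (n (r k)) (V (r k)) x) \<longlonglongrightarrow> f x"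
    using grid_l1_AE_subseq[OF assms(1-3)] .
  have "AE x in unit_interval_measure. x \<in> space unit_interval_measure" by (rule AE_space)
  with r(2) show ?thesis
  proof eventually_elim
    case (elim x)
    have "grid_step (n (r k)) (V (r k)) x \<le> b" for k
      unfolding grid_step_def by (rule le, rule grid_index_in_range) (use elim assms(1) in auto)
    then show ?case using elim(1) by (intro LIMSEQ_le_const2) auto
  qed
qed

text \<open>Sampling points can be moved into a set of full measure by one common small shift to the
  left: the bad shifts form a finite union of reflected null sets. A common shift keeps
  the order of the points, coincident ones included.\<close>

lemma AE_small_left_shift:
  assumes AE: "AE y in unit_interval_measure. Q y" and X: "finite X" "X \<subseteq> {0<..<1}"
  obtains h :: "nat \<Rightarrow> real" where "\<And>j. 0 < h j" "h \<longlonglongrightarrow> 0"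
    "\<And>j x. x \<in> X \<Longrightarrow> x - h j \<in> {0<..<1} \<and> Q (x - h j)"
proof -
  have "AE y in lebesgue. y \<in> {0<..<1} \<longrightarrow> Q y"
    using AE by (subst (asm) AE_restrict_space_iff) auto
  then obtain N where N: "\<And>y. y \<in> space lebesgue - N \<Longrightarrow> y \<in> {0<..<1} \<longrightarrow> Q y" "N \<in> null_sets lebesgue"
    by (rule AE_E3) blast
  have "negligible ((\<lambda>y. x - y) ` N)" for x
  proof -
    have "negligible N" using N(2) by (simp add: negligible_iff_null_sets)
    then show ?thesis
      by (intro negligible_differentiable_image_negligible) (auto intro!: derivative_intros)
  qed
  then have negl: "negligible (\<Union>x\<in>X. (\<lambda>y. x - y) ` N)"
    using X(1) by (intro negligible_Union) auto
  have "\<exists>h. 0 < h \<and> h < 1 / (real j + 1) \<and> (\<forall>x\<in>X. x - h \<in> {0<..<1} \<and> Q (x - h))" for j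
  proof -
    define d where "d = Min (insert (1 / (real j + 1)) X)"
    have d: "0 < d" "d \<le> 1 / (real j + 1)" "\<And>x. x \<in> X \<Longrightarrow> d \<le> x"
      unfolding d_def using X by (auto simp del: Min_insert intro!: Min_le) 
    have "\<not> negligible {0<..<d}"
      using d(1) negligible_interval(2)[of 0 d] by (simp add: box_real)
    then have "\<not> {0<..<d} \<subseteq> (\<Union>x\<in>X. (\<lambda>y. x - y) ` N)"
      using negl negligible_subset by blast
    then obtain h where "h \<in> {0<..<d}" "h \<notin> (\<Union>x\<in>X. (\<lambda>y. x - y) ` N)" by blast
    then have h: "0 < h" "h < d" "\<And>x. x \<in> X \<Longrightarrow> h \<notin> (\<lambda>y. x - y) ` N"
      by simp_all
    have "x - h \<in> {0<..<1} \<and> Q (x - h)" if "x \<in> X" for x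
    proof -
      have "x - h \<in> {0<..<1}" using h(1,2) d(3)[OF that] that X(2) by force
      moreover have "x - h \<notin> N" using h(3)[OF that] by (auto simp: image_iff)
      ultimately show ?thesis using N(1)[of "x - h"] by simp
    qed
    then show ?thesis using h(1,2) d(2) by (intro exI[of _ h]) auto
  qed
  then obtain h where h: "\<And>j. 0 < h j" "\<And>j. h j < 1 / (real j + 1)"
    "\<And>j x. x \<in> X \<Longrightarrow> x - h j \<in> {0<..<1} \<and> Q (x - h j)" by metis
  have "h \<longlonglongrightarrow> 0"
  proof (rule tendsto_sandwich[OF _ _ tendsto_const LIMSEQ_inverse_real_of_nat])
    show "\<forall>\<^sub>F j in sequentially. h j \<le> inverse (real (Suc j))"
      using h(2) by (intro always_eventually allI less_imp_le) (simp add: inverse_eq_divide add.commute)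
  qed (use h(1) in \<open>auto intro!: always_eventually less_imp_le\<close>)
  then show ?thesis using h that by blast
qed

lemma left_continuous_shift_tendsto:
  fixes g :: "real \<Rightarrow> real"
  assumes "continuous (at_left x) g" "\<And>j. 0 < h j" "h \<longlonglongrightarrow> 0"
  shows "(\<lambda>j. g (x - h j)) \<longlonglongrightarrow> g x"
proof -
  have "filterlim (\<lambda>j. x - h j) (at_left x) sequentially"
    using tendsto_diff[OF tendsto_const[of x] assms(3)] assms(2)
    by (intro tendsto_imp_filterlim_at_left) (auto intro!: always_eventually)
  then show ?thesis
    using assms(1) unfolding continuous_within by (rule filterlim_compose[rotated])
qed

lemma left_cont_rep_le:
  assumes g: "is_left_cont_rep 0 1 f g" and "AE x in unit_interval_measure. f x \<le> b" and x: "x \<in> {0<..<1}"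
  shows "g x \<le> b"
proof -
  have "AE y in unit_interval_measure. g y = f y" using g by (simp add: is_left_cont_rep_def)
  with assms(2) have "AE y in unit_interval_measure. g y \<le> b" by eventually_elim simp
  then obtain h where h: "\<And>j. 0 < h j" "h \<longlonglongrightarrow> 0" "\<And>j y. y \<in> {x} \<Longrightarrow> y - h j \<in> {0<..<1} \<and> g (y - h j) \<le> b"
    by (rule AE_small_left_shift[where X="{x}"]) (use x in auto)
  have "continuous (at_left x) g" using g x by (auto simp: is_left_cont_rep_def)
  from left_continuous_shift_tendsto[OF this h(1,2)] show ?thesis
    using h(3) by (intro LIMSEQ_le_const2) auto
qed

lemma jump_sum_pos_mono:
  assumes "a \<le> b" shows "jump_sum (max 0) a v \<le> jump_sum (max 0) b v"
  unfolding jump_sum_def using assms by (intro sum_mono2) auto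

lemma jump_sum_nonneg: "(\<And>x. 0 \<le> f x) \<Longrightarrow> 0 \<le> jump_sum f a v"
  unfolding jump_sum_def by (intro sum_nonneg) auto

lemma increment_le_jump_sum_diff:
  assumes "1 \<le> a" "a \<le> b"
  shows "v b - v a \<le> jump_sum (max 0) b v - jump_sum (max 0) a v"
  using assms(2)
proof (induction b rule: dec_induct)
  case (step b)
  then have "jump_sum (max 0) (Suc b) v = jump_sum (max 0) b v + max 0 (v (Suc b) - v b)"
    using assms(1) by (simp add: jump_sum_def)
  then show ?case using step.IH by linarith
qed simp

lemma alternating_sum_pairs:
  fixes z :: "nat \<Rightarrow> real"
  shows "(\<Sum>i=1..2*m. (-1) ^ i * z i) = (\<Sum>j=1..m. z (2*j) - z (2*j - 1))"
  by (induction m) (auto simp: sum.nat_ivl_Suc')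

text \<open>The alternating sum consists of increments over consecutive disjoint index ranges, and
  each increment is at most the positive variation over its range.\<close>

lemma alternating_sum_le_jump_sum:
  assumes a: "\<And>i. i \<in> {1..2*m} \<Longrightarrow> a i \<in> {1..N}" and mono: "\<And>i. i \<in> {1..<2*m} \<Longrightarrow> a i \<le> a (i + 1)"
  shows "(\<Sum>i=1..2*m. (-1) ^ i * v (a i)) \<le> jump_sum (max 0) N v"
proof (cases "m = 0")
  case False
  let ?p = "\<lambda>i. jump_sum (max 0) i v"
  have p0: "0 \<le> ?p i" for i by (rule jump_sum_nonneg) simp
  have "(\<Sum>j=1..k. v (a (2*j)) - v (a (2*j - 1))) \<le> ?p (a (2*k))" if "k \<le> m" for k
    using that
  proof (induction k)
    case 0 show ?case using p0 by simp
  next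
    case (Suc k)
    have "(\<Sum>j=1..Suc k. v (a (2*j)) - v (a (2*j - 1)))
        = (\<Sum>j=1..k. v (a (2*j)) - v (a (2*j - 1))) + (v (a (2*k+2)) - v (a (2*k+1)))" by simp
    moreover have "v (a (2*k+2)) - v (a (2*k+1)) \<le> ?p (a (2*k+2)) - ?p (a (2*k+1))"
      using Suc.prems a[of "2*k+1"] mono[of "2*k+1"] by (intro increment_le_jump_sum_diff) auto
    moreover have "(\<Sum>j=1..k. v (a (2*j)) - v (a (2*j - 1))) \<le> ?p (a (2*k+1))"
    proof (cases "k = 0")
      case False
      have "?p (a (2*k)) \<le> ?p (a (2*k+1))"
        using Suc.prems False mono[of "2*k"] by (intro jump_sum_pos_mono) auto
      then show ?thesis using Suc by simp
    qed (use p0 in simp)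
    ultimately show ?case by simp
  qed
  from this[of m] have "(\<Sum>i=1..2*m. (-1) ^ i * v (a i)) \<le> ?p (a (2*m))"
    unfolding alternating_sum_pairs by blast
  also have "\<dots> \<le> ?p N" using a[of "2*m"] False by (intro jump_sum_pos_mono) auto
  finally show ?thesis .
qed (simp add: jump_sum_nonneg)

text \<open>Lower semicontinuity of the positive variation under \<open>L1\<close> convergence: along a subsequence
  the step functions converge at the shifted points, where their alternating sums obey
  the bound, and left continuity removes the shift.\<close>

lemma alternating_sum_lsc:
  assumes n: "\<And>k. 0 < n k" and f: "integrable unit_interval_measure f" and conv: "grid_l1_tendsto n V f"
    and T: "\<And>k. jump_sum (max 0) (n k) (V k) \<le> T"
    and g: "is_left_cont_rep 0 1 f g"
    and m: "1 \<le> m" and x: "0 < x 1" "\<forall>i\<in>{1..<2*m}. x i \<le> x (i + 1)" "x (2*m) < (1::real)"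
  shows "(\<Sum>i=1..2*m. (-1) ^ i * g (x i)) \<le> T"
proof -
  have mono: "x i \<le> x j" if "1 \<le> i" "i \<le> j" "j \<le> 2 * m" for i j
    using that(2,3)
  proof (induction j rule: dec_induct)
    case (step k)
    then have "x k \<le> x (k + 1)" using x(2) that(1) by auto
    then show ?case using step by simp
  qed simp
  have x01: "x i \<in> {0<..<1}" if "i \<in> {1..2*m}" for i
    using mono[of 1 i] mono[of i "2*m"] that x(1,3) by auto
  obtain r where r: "strict_mono r"
    "AE y in unit_interval_measure. (\<lambda>k. grid_step (n (r k)) (V (r k)) y) \<longlonglongrightarrow> f y"
    using grid_l1_AE_subseq[OF n f conv] .
  have "AE y in unit_interval_measure. g y = f y" using g by (simp add: is_left_cont_rep_def)
  with r(2) have "AE y in unit_interval_measure. (\<lambda>k. grid_step (n (r k)) (V (r k)) y) \<longlonglongrightarrow> g y"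
    by eventually_elim simp
  then obtain h where h: "\<And>j. 0 < h j" "h \<longlonglongrightarrow> 0"
    "\<And>j y. y \<in> x ` {1..2*m} \<Longrightarrow> y - h j \<in> {0<..<1} \<and> (\<lambda>k. grid_step (n (r k)) (V (r k)) (y - h j)) \<longlonglongrightarrow> g (y - h j)"
    by (rule AE_small_left_shift[where X="x ` {1..2*m}"]) (use x01 in auto)
  have shifted: "(\<Sum>i=1..2*m. (-1) ^ i * g (x i - h j)) \<le> T" for j
  proof (rule LIMSEQ_le_const2)
    show "(\<lambda>k. \<Sum>i=1..2*m. (-1) ^ i * grid_step (n (r k)) (V (r k)) (x i - h j))
        \<longlonglongrightarrow> (\<Sum>i=1..2*m. (-1) ^ i * g (x i - h j))"
      using h(3) by (intro tendsto_sum tendsto_mult tendsto_const) auto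
    have "(\<Sum>i=1..2*m. (-1) ^ i * grid_step (n (r k)) (V (r k)) (x i - h j)) \<le> T" for k
    proof -
      have "(\<Sum>i=1..2*m. (-1) ^ i * V (r k) (nat \<lceil>real (n (r k)) * (x i - h j)\<rceil>)) \<le> jump_sum (max 0) (n (r k)) (V (r k))"
      proof (rule alternating_sum_le_jump_sum)
        show "nat \<lceil>real (n (r k)) * (x i - h j)\<rceil> \<in> {1..n (r k)}" if "i \<in> {1..2*m}" for i
          by (rule grid_index_in_range[OF n]) (use h(3) that in blast)
        show "nat \<lceil>real (n (r k)) * (x i - h j)\<rceil> \<le> nat \<lceil>real (n (r k)) * (x (i+1) - h j)\<rceil>" if "i \<in> {1..<2*m}" for i
          using x(2) that by (intro nat_mono ceiling_mono mult_left_mono) auto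
      qed
      also have "\<dots> \<le> T" by (rule T)
      finally show ?thesis by (simp add: grid_step_def)
    qed
    then show "\<exists>N. \<forall>k\<ge>N. (\<Sum>i=1..2*m. (-1) ^ i * grid_step (n (r k)) (V (r k)) (x i - h j)) \<le> T" by blast
  qed
  have "(\<lambda>j. \<Sum>i=1..2*m. (-1) ^ i * g (x i - h j)) \<longlonglongrightarrow> (\<Sum>i=1..2*m. (-1) ^ i * g (x i))"
    using g x01 by (intro tendsto_sum tendsto_mult tendsto_const left_continuous_shift_tendsto[OF _ h(1,2)])
      (auto simp: is_left_cont_rep_def)
  then show ?thesis using shifted by (intro LIMSEQ_le_const2) auto
qed

section \<open>Left-continuous representatives\<close>

text \<open>Helly's selection theorem for right-continuous functions, reflected at the origin.\<close>

lemma Helly_selection_left_continuous: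
  fixes f :: "nat \<Rightarrow> real \<Rightarrow> real"
  assumes lcont: "\<And>k x. continuous (at_left x) (f k)" and mono: "\<And>k. mono (f k)"
    and bdd: "\<And>k x. \<bar>f k x\<bar> \<le> M"
  obtains s F where "strict_mono s" "\<And>x. continuous (at_left x) F" "mono F"
    "\<And>x. continuous (at x) F \<Longrightarrow> (\<lambda>k. f (s k) x) \<longlonglongrightarrow> F x"
proof -
  have rc: "continuous (at_right x) (\<lambda>y. - f k (- y))" for k x
    using tendsto_minus[OF lcont[of "-x" k, unfolded continuous_within]]
    unfolding continuous_within by (subst at_right_minus) (simp add: filterlim_filtermap)
  have mn: "mono (\<lambda>y. - f k (- y))" for k
    using mono[of k] by (auto simp: mono_def)
  have bd: "\<bar>- f k (- y)\<bar> \<le> M" for k y using bdd by simp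
  obtain s G where s: "strict_mono s" and G: "\<And>x. continuous (at_right x) G" "mono G"
    "\<And>x. continuous (at x) G \<Longrightarrow> (\<lambda>k. - f (s k) (- x)) \<longlonglongrightarrow> G x"
    using Helly_selection[of "\<lambda>k y. - f k (- y)", OF rc mn bd] by blast
  show ?thesis
  proof (rule that[of s "\<lambda>x. - G (- x)"])
    show "continuous (at_left x) (\<lambda>x. - G (- x))" for x
      using tendsto_minus[OF G(1)[of "-x", unfolded continuous_within]]
      unfolding continuous_within by (subst at_left_minus) (simp add: filterlim_filtermap)
    show "mono (\<lambda>x. - G (- x))" using G(2) by (auto simp: mono_def)
    show "(\<lambda>k. f (s k) x) \<longlonglongrightarrow> - G (- x)" if "continuous (at x) (\<lambda>x. - G (- x))" for x
    proof -
      have "isCont ((\<lambda>x. - G (- x)) \<circ> uminus) (- x)"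
        using that by (intro continuous_at_compose) auto
      then have "isCont (\<lambda>y. - (((\<lambda>x. - G (- x)) \<circ> uminus) y)) (- x)"
        by (rule continuous_minus)
      then have "isCont G (- x)" by (simp add: o_def)
      from tendsto_minus[OF G(3)[OF this]] show ?thesis by simp
    qed
  qed (rule s)
qed

lemma continuous_at_left_ceiling:
  fixes H :: "nat \<Rightarrow> real" and c :: real
  assumes "0 < c"
  shows "continuous (at_left x) (\<lambda>y. H (nat \<lceil>c * y\<rceil>))"
proof -
  define l where "l = (of_int \<lceil>c * x\<rceil> - 1) / c"
  have "l < x" using assms unfolding l_def by (simp add: field_simps) linarith
  have "\<lceil>c * y\<rceil> = \<lceil>c * x\<rceil>" if "l < y" "y < x" for y
  proof (rule ceiling_unique)
    show "of_int \<lceil>c * x\<rceil> - 1 < c * y" using that assms by (simp add: l_def field_simps)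
    have "c * y \<le> c * x" using that assms by simp
    then show "c * y \<le> of_int \<lceil>c * x\<rceil>" by linarith
  qed
  then have "eventually (\<lambda>y. H (nat \<lceil>c * x\<rceil>) = H (nat \<lceil>c * y\<rceil>)) (at_left x)"
    using \<open>l < x\<close> unfolding eventually_at_left_field by (intro exI[of _ l]) auto
  then show ?thesis unfolding continuous_within by (rule Lim_transform_eventually[OF tendsto_const])
qed

lemma AE_unit_continuous_mono:
  assumes "mono F" shows "AE x in unit_interval_measure. continuous (at x) (F :: real \<Rightarrow> real)"
proof -
  have "countable {a. \<not> continuous (at a) F}" by (rule mono_ctble_discont[OF assms])
  then have "{a. \<not> continuous (at a) F} \<in> null_sets lebesgue"
    by (intro null_sets_completionI countable_imp_null_set_lborel)
  then have "AE x in lebesgue. continuous (at x) F" by (rule AE_I') auto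
  then have "AE x in lebesgue. x \<in> {0<..<1} \<longrightarrow> continuous (at x) F" by eventually_elim simp
  then show ?thesis by (subst AE_restrict_space_iff) auto
qed

text \<open>The approximations are differences of monotone step functions, namely of their positive and
  negative variations. Helly selection gives left-continuous monotone limits of both parts,
  and the difference of these limits agrees with \<open>f\<close> at almost every point.\<close>

lemma bounded_variation_limit_left_cont_rep:
  assumes n: "\<And>k. 0 < n k" and f: "integrable unit_interval_measure f" and conv: "grid_l1_tendsto n V f"
    and bound: "\<And>k i. i \<in> {1..n k} \<Longrightarrow> \<bar>V k i\<bar> \<le> B" and jumps: "\<And>k. jump_sum abs (n k) (V k) \<le> B"
  obtains g where "is_left_cont_rep 0 1 f g"
proof -
  obtain r where r: "strict_mono r"
    "AE y in unit_interval_measure. (\<lambda>k. grid_step (n (r k)) (V (r k)) y) \<longlonglongrightarrow> f y"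
    using grid_l1_AE_subseq[OF n f conv] .
  \<comment> \<open>The index is capped at \<open>n k\<close> because Helly selection needs functions that are bounded and
    monotone on the whole line.\<close>
  define up where "up k x = V k 1 + jump_sum (max 0) (min (n k) (nat \<lceil>real (n k) * x\<rceil>)) (V k)" for k x
  define down where "down k x = jump_sum (max 0) (min (n k) (nat \<lceil>real (n k) * x\<rceil>)) (\<lambda>i. - V k i)" for k x
  have split: "V k 1 + jump_sum (max 0) i (V k) - jump_sum (max 0) i (\<lambda>i. - V k i) = V k i" if "1 \<le> i" for k i
  proof -
    have "jump_sum (max 0) i (V k) - jump_sum (max 0) i (\<lambda>i. - V k i) = (\<Sum>j=1..<i. V k (Suc j) - V k j)"
      unfolding jump_sum_def sum_subtractf[symmetric] by (rule sum.cong) (auto simp: max_def)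
    also have "\<dots> = V k i - V k 1" using that by (intro sum_Suc_diff') auto
    finally show ?thesis by simp
  qed
  have le: "jump_sum (max 0) (min (n k) i) (V k) \<le> B" "jump_sum (max 0) (min (n k) i) (\<lambda>i. - V k i) \<le> B" for k i
  proof -
    have "jump_sum (max 0) (n k) (V k) \<le> jump_sum abs (n k) (V k)"
      "jump_sum (max 0) (n k) (\<lambda>i. - V k i) \<le> jump_sum abs (n k) (V k)"
      unfolding jump_sum_def by (intro sum_mono; simp)+
    then show "jump_sum (max 0) (min (n k) i) (V k) \<le> B" "jump_sum (max 0) (min (n k) i) (\<lambda>i. - V k i) \<le> B"
      using jumps[of k] jump_sum_pos_mono[of "min (n k) i" "n k" "V k"]
        jump_sum_pos_mono[of "min (n k) i" "n k" "\<lambda>i. - V k i"] by auto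
  qed
  have nonneg: "0 \<le> jump_sum (max 0) i v" for i v by (rule jump_sum_nonneg) simp
  have lc: "continuous (at_left x) (up k)" "continuous (at_left x) (down k)" for k x
  proof -
    have "0 < real (n k)" using n by simp
    then show "continuous (at_left x) (up k)" "continuous (at_left x) (down k)"
      unfolding up_def down_def
      by (rule continuous_at_left_ceiling[where H="\<lambda>i. V k 1 + jump_sum (max 0) (min (n k) i) (V k)"]
        continuous_at_left_ceiling[where H="\<lambda>i. jump_sum (max 0) (min (n k) i) (\<lambda>i. - V k i)"])+
  qed
  have mono: "mono (up k)" "mono (down k)" for k
    unfolding up_def down_def
    by (auto intro!: monoI jump_sum_pos_mono min.mono nat_mono ceiling_mono mult_left_mono)
  have bd: "\<bar>up k x\<bar> \<le> 2 * B" "\<bar>down k x\<bar> \<le> 2 * B" for k x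
  proof -
    have "\<bar>V k 1\<bar> \<le> B" using bound[of 1 k] n[of k] by simp
    then show "\<bar>up k x\<bar> \<le> 2 * B" "\<bar>down k x\<bar> \<le> 2 * B"
      using le[of k "nat \<lceil>real (n k) * x\<rceil>"]
      nonneg[of "min (n k) (nat \<lceil>real (n k) * x\<rceil>)" "V k"]
      nonneg[of "min (n k) (nat \<lceil>real (n k) * x\<rceil>)" "\<lambda>i. - V k i"]
      unfolding up_def down_def by linarith+
  qed
  obtain s1 F where F: "strict_mono s1" "\<And>x. continuous (at_left x) F" "mono F"
    "\<And>x. continuous (at x) F \<Longrightarrow> (\<lambda>k. up (r (s1 k)) x) \<longlonglongrightarrow> F x"
    using Helly_selection_left_continuous[of "\<lambda>k. up (r k)", OF lc(1) mono(1) bd(1)] by blast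
  obtain s2 G where G: "strict_mono s2" "\<And>x. continuous (at_left x) G" "mono G"
    "\<And>x. continuous (at x) G \<Longrightarrow> (\<lambda>k. down (r (s1 (s2 k))) x) \<longlonglongrightarrow> G x"
    using Helly_selection_left_continuous[of "\<lambda>k. down (r (s1 k))", OF lc(2) mono(2) bd(2)] by blast
  have "AE x in unit_interval_measure. F x - G x = f x"
    using r(2) AE_unit_continuous_mono[OF F(3)] AE_unit_continuous_mono[OF G(3)]
      AE_space[of unit_interval_measure]
  proof eventually_elim
    case (elim x)
    have "(\<lambda>k. up (r (s1 (s2 k))) x - down (r (s1 (s2 k))) x) \<longlonglongrightarrow> F x - G x"
      using LIMSEQ_subseq_LIMSEQ[OF F(4)[OF elim(2)] G(1)] G(4)[OF elim(3)]
      by (intro tendsto_diff) (auto simp: o_def)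
    moreover have "up k x - down k x = grid_step (n k) (V k) x" for k
    proof -
      have i: "nat \<lceil>real (n k) * x\<rceil> \<in> {1..n k}"
        by (rule grid_index_in_range[OF n]) (use elim(4) in auto)
      then have "min (n k) (nat \<lceil>real (n k) * x\<rceil>) = nat \<lceil>real (n k) * x\<rceil>" by auto
      then show ?thesis using split[of "nat \<lceil>real (n k) * x\<rceil>" k] i
        by (simp add: up_def down_def grid_step_def)
    qed
    moreover have "(\<lambda>k. grid_step (n (r (s1 (s2 k)))) (V (r (s1 (s2 k)))) x) \<longlonglongrightarrow> f x"
      using LIMSEQ_subseq_LIMSEQ[OF elim(1) strict_mono_o[OF F(1) G(1)]] by (simp add: o_def)
    ultimately show ?case by (simp add: LIMSEQ_unique)
  qed
  then have "is_left_cont_rep 0 1 f (\<lambda>x. F x - G x)"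
    using F(2) G(2) by (auto simp: is_left_cont_rep_def intro: continuous_diff)
  then show ?thesis by (rule that)
qed

section \<open>Sampling a left-continuous function\<close>

text \<open>The left end point of the \<open>i\<close>-th cell, so that for fixed \<open>x\<close> the sample point of the cell
  of \<open>x\<close> tends to \<open>x\<close> strictly from the left, where a left-continuous function can be
  controlled. The maximum keeps the first sample point inside \<open>(0,1)\<close>.\<close>

definition sample_point :: "nat \<Rightarrow> nat \<Rightarrow> real" where
  "sample_point N i = max ((real i - 1) / real N) (1 / (2 * real N))"

lemma sample_point_in_unit: "i \<in> {1..N} \<Longrightarrow> sample_point N i \<in> {0<..<1}"
  by (auto simp: sample_point_def less_max_iff_disj divide_simps)

lemma sample_point_mono: "i \<le> j \<Longrightarrow> sample_point N i \<le> sample_point N j"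
  unfolding sample_point_def by (intro max.mono divide_right_mono) auto

lemma sampled_tendsto:
  assumes n: "strict_mono n" "\<And>k. 0 < n k" and f: "integrable unit_interval_measure f"
    and g: "is_left_cont_rep 0 1 f g" and B: "\<And>x. x \<in> {0<..<1} \<Longrightarrow> \<bar>g x\<bar> \<le> B"
  shows "grid_l1_tendsto n (\<lambda>k i. g (sample_point (n k) i)) f"
proof -
  interpret prob_space unit_interval_measure by (rule prob_space_unit_interval)
  let ?S = "\<lambda>k. grid_step (n k) (\<lambda>i. g (sample_point (n k) i))"
  have n_top: "filterlim (\<lambda>k. real (n k)) at_top sequentially"
    using filterlim_compose[OF filterlim_real_sequentially filterlim_subseq[OF n(1)]] .
  have ptw: "(\<lambda>k. ?S k x) \<longlonglongrightarrow> g x" if x: "x \<in> {0<..<1}" for x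
  proof -
    define y where "y k = sample_point (n k) (nat \<lceil>real (n k) * x\<rceil>)" for k
    have ceil: "real (nat \<lceil>real (n k) * x\<rceil>) - 1 < real (n k) * x" "real (n k) * x \<le> real (nat \<lceil>real (n k) * x\<rceil>)" for k
    proof -
      have "0 \<le> real (n k) * x" using x by simp
      then have "real (nat \<lceil>real (n k) * x\<rceil>) = of_int \<lceil>real (n k) * x\<rceil>" by simp
      then show "real (nat \<lceil>real (n k) * x\<rceil>) - 1 < real (n k) * x" "real (n k) * x \<le> real (nat \<lceil>real (n k) * x\<rceil>)"
        by linarith+
    qed
    have inv0: "(\<lambda>k. 1 / real (n k)) \<longlonglongrightarrow> 0"
      by (rule real_tendsto_divide_at_top[OF tendsto_const n_top])
    have lower: "x - 1 / real (n k) \<le> y k" for k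
    proof -
      have "x - 1 / real (n k) \<le> (real (nat \<lceil>real (n k) * x\<rceil>) - 1) / real (n k)"
        using ceil(2)[of k] n(2)[of k] by (simp add: field_simps)
      then show ?thesis by (simp add: y_def sample_point_def)
    qed
    have "\<forall>\<^sub>F k in sequentially. 1 / real (n k) < x"
      using order_tendstoD(2)[OF inv0] x by auto
    then have less: "\<forall>\<^sub>F k in sequentially. y k < x"
    proof eventually_elim
      case (elim k)
      have "1 / (2 * real (n k)) \<le> 1 / real (n k)" using n(2)[of k] by (simp add: field_simps)
      moreover have "(real (nat \<lceil>real (n k) * x\<rceil>) - 1) / real (n k) < x"
        using ceil(1)[of k] n(2)[of k] by (simp add: field_simps)
      ultimately show ?case using elim by (simp add: y_def sample_point_def)
    qed
    have "y \<longlonglongrightarrow> x"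
    proof (rule tendsto_sandwich[OF _ _ _ tendsto_const])
      show "(\<lambda>k. x - 1 / real (n k)) \<longlonglongrightarrow> x" using tendsto_diff[OF tendsto_const inv0] by simp
      show "\<forall>\<^sub>F k in sequentially. y k \<le> x" using less by eventually_elim simp
    qed (use lower in simp)
    then have "filterlim y (at_left x) sequentially"
      using less by (intro tendsto_imp_filterlim_at_left) auto
    moreover have "(g \<longlongrightarrow> g x) (at_left x)"
      using g x by (auto simp: is_left_cont_rep_def continuous_within)
    ultimately have "(\<lambda>k. g (y k)) \<longlonglongrightarrow> g x" by (rule filterlim_compose[rotated])
    then show ?thesis by (simp add: grid_step_def y_def)
  qed
  have gf: "AE x in unit_interval_measure. g x = f x" using g by (simp add: is_left_cont_rep_def)
  have meas: "?S k \<in> borel_measurable unit_interval_measure" for k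
    by (rule borel_measurable_integrable[OF integrable_grid_step[OF n(2)]])
  have [measurable]: "f \<in> borel_measurable unit_interval_measure"
    by (rule borel_measurable_integrable[OF f])
  have "(\<lambda>k. LINT x|unit_interval_measure. \<bar>?S k x - f x\<bar>) \<longlonglongrightarrow> (LINT x|unit_interval_measure. (0::real))"
  proof (rule integral_dominated_convergence[where w="\<lambda>_. 2 * B"])
    show "AE x in unit_interval_measure. (\<lambda>k. \<bar>?S k x - f x\<bar>) \<longlonglongrightarrow> 0"
      using gf AE_space[of unit_interval_measure]
    proof eventually_elim
      case (elim x)
      then have "(\<lambda>k. ?S k x - f x) \<longlonglongrightarrow> 0" using ptw[of x] by (simp add: LIM_zero_iff)
      then show ?case by (rule tendsto_rabs_zero)
    qed
    show "AE x in unit_interval_measure. norm \<bar>?S k x - f x\<bar> \<le> 2 * B" for k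
      using gf AE_space[of unit_interval_measure]
    proof eventually_elim
      case (elim x)
      then have x: "x \<in> {0<..<1}" by simp
      have "\<bar>?S k x\<bar> \<le> B"
        unfolding grid_step_def by (rule B[OF sample_point_in_unit[OF grid_index_in_range[OF n(2) x]]])
      then show ?case using B[OF x] elim(1) by auto
    qed
  qed (use meas in auto)
  then show ?thesis by (simp add: grid_l1_tendsto_def)
qed

text \<open>The positive jumps of the sampled values form an alternating sum over the pairs
  \<open>(y i, y (i + 1))\<close>. At the other indices, the last one included, the degenerate pair
  \<open>(y i, y i)\<close> contributes zero and keeps the number of points equal to \<open>2 * N\<close>.\<close>

lemma sampled_jump_sum_le_TV_plus:
  fixes f :: "real \<Rightarrow> real"
  defines "g \<equiv> left_cont_rep 0 1 f"
  assumes N: "0 < N"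
  shows "ereal (jump_sum (max 0) N (\<lambda>i. g (sample_point N i))) \<le> TV_plus 0 1 f"
proof -
  let ?y = "sample_point N"
  define x where "x j = (let i = (j + 1) div 2 in
      if even j \<and> i < N \<and> g (?y i) < g (?y (i + 1)) then ?y (i + 1) else ?y i)" for j
  have odd_x: "x (2*i - 1) = ?y i" if "1 \<le> i" for i
  proof -
    have "(2*i - 1 + 1) div 2 = i" "odd (2*i - 1)" using that by auto
    then show ?thesis by (simp add: x_def Let_def)
  qed
  have even_x: "x (2*i) = (if i < N \<and> g (?y i) < g (?y (i + 1)) then ?y (i + 1) else ?y i)" for i
    by (simp add: x_def Let_def)
  have "(\<Sum>i=1..2*N. (-1) ^ i * g (x i)) = (\<Sum>j=1..N. g (x (2*j)) - g (x (2*j - 1)))"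
    by (rule alternating_sum_pairs)
  also have "\<dots> = (\<Sum>j=1..N. if j < N then max 0 (g (?y (j + 1)) - g (?y j)) else 0)"
    by (rule sum.cong) (auto simp: odd_x[simplified] even_x max_def)
  also have "\<dots> = (\<Sum>j=1..<N. max 0 (g (?y (j + 1)) - g (?y j)))"
    by (rule sum.mono_neutral_cong_right) auto
  finally have eq: "jump_sum (max 0) N (\<lambda>i. g (?y i)) = (\<Sum>i=1..2*N. (-1) ^ i * g (x i))"
    by (simp add: jump_sum_def)
  have mono: "x i \<le> x (i + 1)" for i
  proof (cases "even i")
    case True
    then obtain j where j: "i = 2 * j" by blast
    have "x (i + 1) = ?y (j + 1)" using odd_x[of "j + 1"] j by simp
    then show ?thesis using even_x[of j] j sample_point_mono[of j "j + 1" N] by auto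
  next
    case False
    then obtain j where j: "i = 2 * j + 1" by (blast elim: oddE)
    have "x i = ?y (j + 1)" using odd_x[of "j + 1"] j by simp
    moreover have "?y (j + 1) \<le> x (i + 1)"
      using even_x[of "j + 1"] j sample_point_mono[of "j + 1" "j + 2" N] by (auto simp: add.commute)
    ultimately show ?thesis by simp
  qed
  have "0 < x 1" using odd_x[of 1] sample_point_in_unit[of 1 N] N by auto
  moreover have "x (2*N) < 1" using even_x[of N] sample_point_in_unit[of N N] N by auto
  ultimately show ?thesis
    unfolding TV_plus_def g_def[symmetric] eq using mono N
    by (intro Sup_upper CollectI exI[of _ N] exI[of _ x] conjI refl ballI) simp_all
qed

section \<open>Monotonicity in time\<close>

text \<open>The companion started from the initial data \<open>U k 0\<close> themselves has uniformly bounded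
  values and total variation at time \<open>t\<close>, so the limit \<open>u t\<close> has bounded variation. This is
  what gives \<open>left_cont_rep\<close>, and hence \<open>TV_plus\<close>, its meaning.\<close>

lemma (in semidiscrete_approximation) solution_left_cont_rep:
  assumes "0 \<le> t"
  shows "is_left_cont_rep 0 1 (u t) (left_cont_rep 0 1 (u t))"
    and "x \<in> {0<..<1} \<Longrightarrow> \<bar>left_cont_rep 0 1 (u t) x\<bar> \<le> B"
proof -
  obtain V where V: "grid_l1_tendsto n V (u t)"
    "\<And>k. less_oscillating (n k) (V k) (U k 0)"
    using companion_limit[OF order_refl assms converges[OF order_refl]] by blast
  have up: "V k i \<le> B" if "i \<in> {1..n k}" for k i
    by (rule less_oscillating_upper[OF V(2) _ that]) (use initial_bound in \<open>simp add: abs_le_iff\<close>)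
  have lo: "- B \<le> V k i" if "i \<in> {1..n k}" for k i
    by (rule less_oscillating_lower[OF V(2) _ that]) (use initial_bound in \<open>simp add: abs_le_iff minus_le_iff\<close>)
  have bd: "\<bar>V k i\<bar> \<le> B" if "i \<in> {1..n k}" for k i
    using up[OF that] lo[OF that] by linarith
  have tv: "jump_sum abs (n k) (V k) \<le> B" for k
    using less_oscillating_jump_sum[OF V(2) sublinear_jump_cost_abs, of k] initial_jumps[of k] by linarith
  have "\<exists>g. is_left_cont_rep 0 1 (u t) g"
    using bounded_variation_limit_left_cont_rep[OF n_pos integrable_u[OF assms] V(1) bd tv] by blast
  then show rep: "is_left_cont_rep 0 1 (u t) (left_cont_rep 0 1 (u t))"
    unfolding left_cont_rep_def by (rule someI_ex)
  assume x: "x \<in> {0<..<1}"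
  have "AE y in unit_interval_measure. u t y \<le> B"
    by (rule grid_l1_limit_AE_le[OF n_pos integrable_u[OF assms] V(1) up])
  from left_cont_rep_le[OF rep this x] have 1: "left_cont_rep 0 1 (u t) x \<le> B" .
  have neg: "grid_l1_tendsto n (\<lambda>k i. - V k i) (\<lambda>y. - u t y)"
    by (rule grid_l1_tendsto_uminus[OF V(1)])
  have "AE y in unit_interval_measure. - u t y \<le> B"
    by (rule grid_l1_limit_AE_le[OF n_pos _ neg]) (use integrable_u[OF assms] lo in \<open>auto simp: minus_le_iff\<close>)
  moreover have "is_left_cont_rep 0 1 (\<lambda>y. - u t y) (\<lambda>y. - left_cont_rep 0 1 (u t) y)"
    using rep by (auto simp: is_left_cont_rep_def intro: continuous_minus)
  ultimately have "- left_cont_rep 0 1 (u t) x \<le> B" using left_cont_rep_le x by blast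
  then show "\<bar>left_cont_rep 0 1 (u t) x\<bar> \<le> B" using 1 by linarith
qed

text \<open>The companions start here from samples \<open>W k\<close> of the left-continuous representative of
  \<open>u s\<close>, which exceed neither its supremum nor its positive variation. The diffusion steps
  preserve both bounds, and so does the passage to the limit at time \<open>t\<close>.\<close>

lemma (in semidiscrete_approximation) esssup_and_TV_plus_decrease:
  assumes st: "0 \<le> s" "s \<le> t"
  shows "esssup unit_interval_measure (\<lambda>x. ereal (u t x)) \<le> esssup unit_interval_measure (\<lambda>x. ereal (u s x))"
    and "TV_plus 0 1 (u t) \<le> TV_plus 0 1 (u s)"
proof -
  have t: "0 \<le> t" using st by simp
  define g where "g = left_cont_rep 0 1 (u s)"
  have g: "is_left_cont_rep 0 1 (u s) g" "\<And>x. x \<in> {0<..<1} \<Longrightarrow> \<bar>g x\<bar> \<le> B"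
    unfolding g_def using solution_left_cont_rep[OF st(1)] by auto
  define W where "W k i = g (sample_point (n k) i)" for k i
  have W: "grid_l1_tendsto n W (u s)"
    unfolding W_def by (rule sampled_tendsto[OF n_mono n_pos integrable_u[OF st(1)] g])
  obtain V where V: "grid_l1_tendsto n V (u t)"
    "\<And>k. less_oscillating (n k) (V k) (W k)"
    using companion_limit[OF st W] by blast
  have real_bound: "AE x in unit_interval_measure. u t x \<le> b" if "AE x in unit_interval_measure. u s x \<le> b" for b
  proof (rule grid_l1_limit_AE_le[OF n_pos integrable_u[OF t] V(1)])
    have W_le: "W k i \<le> b" if "i \<in> {1..n k}" for k i
      unfolding W_def by (rule left_cont_rep_le[OF g(1) \<open>AE x in unit_interval_measure. u s x \<le> b\<close> sample_point_in_unit[OF that]])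
    show "V k i \<le> b" if "i \<in> {1..n k}" for k i
      by (rule less_oscillating_upper[OF V(2) W_le that])
  qed
  have meas: "(\<lambda>x. ereal (u t x)) \<in> borel_measurable unit_interval_measure"
    using borel_measurable_integrable[OF integrable_u[OF t]] by simp
  show "esssup unit_interval_measure (\<lambda>x. ereal (u t x)) \<le> esssup unit_interval_measure (\<lambda>x. ereal (u s x))"
  proof -
    have E: "AE x in unit_interval_measure. ereal (u s x) \<le> esssup unit_interval_measure (\<lambda>x. ereal (u s x))"
      by (rule esssup_AE)
    show ?thesis
    proof (cases "esssup unit_interval_measure (\<lambda>x. ereal (u s x))")
      case (real b)
      have "AE x in unit_interval_measure. ereal (u t x) \<le> ereal b" using real_bound[of b] E real by simp
      then show ?thesis unfolding real by (rule esssup_I[OF meas])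
    next
      case MInf
      then have "AE x in unit_interval_measure. False" using E by simp
      then show ?thesis using prob_space.AE_False[OF prob_space_unit_interval] by simp
    qed simp
  qed
  show "TV_plus 0 1 (u t) \<le> TV_plus 0 1 (u s)"
  proof -
    have W_le: "ereal (jump_sum (max 0) (n k) (W k)) \<le> TV_plus 0 1 (u s)" for k
      unfolding W_def g_def by (rule sampled_jump_sum_le_TV_plus[OF n_pos])
    show ?thesis
    proof (cases "TV_plus 0 1 (u s)")
      case (real T)
      have V_le: "jump_sum (max 0) (n k) (V k) \<le> T" for k
        using less_oscillating_jump_sum[OF V(2) sublinear_jump_cost_pos, of k] W_le[of k] real by simp
      show ?thesis
        unfolding TV_plus_def[of 0 1 "u t"] real
      proof (rule Sup_least, elim CollectE exE conjE)
        fix z m and x :: "nat \<Rightarrow> real"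
        assume z: "z = ereal (\<Sum>i=1..2*m. (-1) ^ i * left_cont_rep 0 1 (u t) (x i))"
          and x: "1 \<le> m" "0 < x 1" "\<forall>i\<in>{1..<2*m}. x i \<le> x (i + 1)" "x (2*m) < 1"
        show "z \<le> ereal T"
          unfolding z ereal_less_eq(3)
          by (rule alternating_sum_lsc[OF n_pos integrable_u[OF t] V(1) V_le solution_left_cont_rep(1)[OF t] x])
      qed
    next
      case MInf
      then show ?thesis using W_le[of 0] by simp
    qed simp
  qed
qed

lemma essinf_eq_uminus_esssup:
  fixes f :: "'a \<Rightarrow> real"
  assumes "f \<in> borel_measurable M"
  shows "essinf M (\<lambda>x. ereal (f x)) = - esssup M (\<lambda>x. ereal (- f x))"
  using assms ereal_Limsup_uminus[of "ae_filter M" "\<lambda>x. ereal (f x)"]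
  by (simp add: essinf_def esssup_def)

theorem theorem2p7:
  fixes \<phi> :: "real \<Rightarrow> real" and u :: "real \<Rightarrow> real \<Rightarrow> real"
  assumes "perona_malik_nonlinearity \<phi>"
    and "generalized_solution \<phi> u"
  shows "antimono_on {0..} (\<lambda>t. esssup (lebesgue_on {0<..<1}) (\<lambda>x. ereal (u t x)))
       \<and> mono_on {0..} (\<lambda>t. essinf (lebesgue_on {0<..<1}) (\<lambda>x. ereal (u t x)))
       \<and> antimono_on {0..} (\<lambda>t. TV_plus 0 1 (u t))
       \<and> antimono_on {0..} (\<lambda>t. TV_minus 0 1 (u t))"
proof -
  obtain C n U B where approx: "semidiscrete_approximation C (deriv \<phi>) n U u B"
    using generalized_solution_approximation[OF assms] .
  note neg = semidiscrete_approximation.negated_approximation[OF approx]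
  have essinf: "essinf unit_interval_measure (\<lambda>x. ereal (u t x))
      = - esssup unit_interval_measure (\<lambda>x. ereal (- u t x))" if "0 \<le> t" for t
    using semidiscrete_approximation.integrable_u[OF approx that]
    by (intro essinf_eq_uminus_esssup borel_measurable_integrable)
  note dec = semidiscrete_approximation.esssup_and_TV_plus_decrease
  show ?thesis
  proof (intro conjI monotone_onI)
    fix s t :: real assume "s \<in> {0..}" "t \<in> {0..}" "s \<le> t"
    then have st: "0 \<le> s" "0 \<le> t" "s \<le> t" by auto
    show "esssup unit_interval_measure (\<lambda>x. ereal (u t x)) \<le> esssup unit_interval_measure (\<lambda>x. ereal (u s x))"
      by (rule dec(1)[OF approx st(1,3)])
    show "essinf unit_interval_measure (\<lambda>x. ereal (u s x)) \<le> essinf unit_interval_measure (\<lambda>x. ereal (u t x))"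
      unfolding essinf[OF st(1)] essinf[OF st(2)] ereal_minus_le_minus by (rule dec(1)[OF neg st(1,3)])
    show "TV_plus 0 1 (u t) \<le> TV_plus 0 1 (u s)"
      by (rule dec(2)[OF approx st(1,3)])
    show "TV_minus 0 1 (u t) \<le> TV_minus 0 1 (u s)"
      unfolding TV_minus_def by (rule dec(2)[OF neg st(1,3)])
  qed
qed

end
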